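(* Let $\mathcal{S}=S_1,S_2,\ldots,S_n$ be an ensemble of labeled stub-stars with maximum degree $\Delta$. For a partition $\lambda$ let $x_\lambda$ denote the number of labeled stub-stars in $\mathcal{S}$ whose labels form the partition $\lambda$. Then: (a) $\mathcal{S}$ is multigraph realizable if and only if for each positive integer $i$, $$\sum_{\lambda\,|\,h(\lambda)=i}x_\lambda N(\lambda,i)\equiv 0\pmod 2,$$ and for all positive integers $i\ne j$, $$\sum_{\lambda\,|\,h(\lambda)=i}x_\lambda N(\lambda,j)=\sum_{\lambda'\,|\,h(\lambda')=j}x_{\lambda'}N(\lambda',i).$$ (b) $\mathcal{S}$ is loopless multigraph realizable if and only if the conditions in (a) hold and for each $i$, $$2\max_{\lambda\,|\,h(\lambda)=i}\left\{\min\{1,x_\lambda\}N(\lambda,i)\right\}\le\sum_{\lambda'\,|\,h(\lambda')=i}x_{\lambda'}N(\lambda',i).$$ (c) $\mathcal{S}$ is simple graph realizable if and only if the conditions in (a) hold, for each $i$ the first $\Delta$ Erdős–Gallai inequalities hold for the degree sequence $D_{i,i}(\mathcal{S})$, and for each $i\ne j$ the first $\Delta-1$ Gale–Ryser inequalities hold for the bipartite degree sequence $D_{i,j}(\mathcal{S})$.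
   Context: A labeled stub-star is a vertex with some number $d$ of stubs (half-edges), each stub labeled by a positive integer; $d$ is its degree. An ensemble is a finite multiset $\mathcal{S}=\{S_1,\ldots,S_n\}$ of labeled stub-stars. A (multi)graph $G$ on vertices $v_1,\ldots,v_n$ is a realization of $\mathcal{S}$ if for each $i$ the multiset of degrees of the neighbors of $v_i$ (counted with edge multiplicity, one for each half-edge at $v_i$; a loop at $v_i$ contributes two neighbors of degree $d(v_i)$ and contributes $2$ to $d(v_i)$) equals the multiset of labels of $S_i$; in particular $d(v_i)$ is the degree of $S_i$. $\mathcal{S}$ is multigraph / loopless multigraph / simple graph realizable if it has a realization that is a multigraph (loops and parallel edges allowed) / loopless multigraph / simple graph. The labels of a stub-star form a partition $\lambda=\{\lambda_1,\ldots,\lambda_k\}$ (a multiset of positive integers); $h(\lambda)=k$ is its height (equal to the degree of the stub-star) and $N(\lambda,j)$ is the number of times $j$ appears in $\lambda$. The chromatic degree $d_{(i,j)}(S)$ of a stub-star $S$ is: the number of labels $j$ of $S$ if $S$ has degree $i$; the number of labels $i$ of $S$ if $S$ has degree $j$; and $0$ if the degree of $S$ is neither $i$ nor $j$. $D_{i,i}(\mathcal{S})$ is the sequence $d_{(i,i)}(S_1),\ldots,d_{(i,i)}(S_n)$. For $i\neq j$, $D_{i,j}(\mathcal{S})$ is the bipartite degree sequence whose first sequence consists of the $d_{(i,j)}(S_l)$ with $S_l$ of degree $i$ and whose second consists of the $d_{(i,j)}(S_l)$ with $S_l$ of degree $j$ (zeros from the other stub-stars may be added to either sequence arbitrarily).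 For a sequence sorted as $d_1\ge\cdots\ge d_n$, the $k$-th Erdős–Gallai inequality ($1\le k\le n$) is $\sum_{g=1}^k d_g\le k(k-1)+\sum_{h=k+1}^n\min\{k,d_h\}$. For a bipartite degree sequence whose first sequence is sorted as $d_{1,1}\ge\cdots\ge d_{1,p}$ and whose second is $d_{2,1},\ldots,d_{2,m}$, the $k$-th Gale–Ryser inequality ($1\le k\le p$) is $\sum_{g=1}^k d_{1,g}\le\sum_{h=1}^m\min\{k,d_{2,h}\}$. "The first $r$" inequalities means those with index $k\le r$ (within the stated range of $k$). *)

theory Defs
  imports "HOL-Library.Multiset"
begin

(* A multigraph on V is given by its finite multiset of edges, each edge being the
   two-element multiset of its end points: {#u, v#} joins u and v, and {#v, v#} is a
   loop at v.  The half-edges of e at v number count e v, and the other end of each of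
   them is the unique element of e - {#v#}. *)

definition multigraph :: "'v set \<Rightarrow> 'v multiset multiset \<Rightarrow> bool" where
  "multigraph V E \<longleftrightarrow> (\<forall>e \<in># E. size e = 2 \<and> set_mset e \<subseteq> V)"

definition loopless_multigraph :: "'v set \<Rightarrow> 'v multiset multiset \<Rightarrow> bool" where
  "loopless_multigraph V E \<longleftrightarrow> multigraph V E \<and> (\<forall>v. {#v, v#} \<notin># E)"

definition simple_graph :: "'v set \<Rightarrow> 'v multiset multiset \<Rightarrow> bool" where
  "simple_graph V E \<longleftrightarrow> loopless_multigraph V E \<and> (\<forall>e. count E e \<le> 1)"

definition degree :: "'v multiset multiset \<Rightarrow> 'v \<Rightarrow> nat" where
  "degree E v = (\<Sum>e \<in># E. count e v)"

(* One entry for each half-edge at v, so a loop at v contributes v twice. *)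
definition neighbours :: "'v multiset multiset \<Rightarrow> 'v \<Rightarrow> 'v multiset" where
  "neighbours E v = (\<Sum>e \<in># E. repeat_mset (count e v) (e - {#v#}))"

(* A labeled stub-star is represented by the multiset of its labels.  For such a partition,
   size is the height (the degree of the stub-star) and count l j is N(l,j).
   An ensemble is an enumeration S_1, ..., S_n of its stub-stars; the vertices of a
   realization are the list positions 0, ..., n - 1. *)

type_synonym stub_star = "nat multiset"

definition is_partition :: "nat multiset \<Rightarrow> bool" where
  "is_partition l \<longleftrightarrow> (\<forall>j \<in># l. j > 0)"

definition ensemble :: "stub_star list \<Rightarrow> bool" where
  "ensemble Ss \<longleftrightarrow> (\<forall>S \<in> set Ss. is_partition S)"

(* Inserting 0 only fixes the value for the empty ensemble. *)
definition max_degree :: "stub_star list \<Rightarrow> nat" where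
  "max_degree Ss = Max (insert 0 (size ` set Ss))"

definition realizes :: "nat multiset multiset \<Rightarrow> stub_star list \<Rightarrow> bool" where
  "realizes E Ss \<longleftrightarrow>
     (\<forall>i < length Ss. image_mset (degree E) (neighbours E i) = Ss ! i)"

definition multigraph_realizable :: "stub_star list \<Rightarrow> bool" where
  "multigraph_realizable Ss \<longleftrightarrow> (\<exists>E. multigraph {..<length Ss} E \<and> realizes E Ss)"

definition loopless_multigraph_realizable :: "stub_star list \<Rightarrow> bool" where
  "loopless_multigraph_realizable Ss \<longleftrightarrow>
     (\<exists>E. loopless_multigraph {..<length Ss} E \<and> realizes E Ss)"

definition simple_graph_realizable :: "stub_star list \<Rightarrow> bool" where
  "simple_graph_realizable Ss \<longleftrightarrow> (\<exists>E. simple_graph {..<length Ss} E \<and> realizes E Ss)"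

definition x_mult :: "stub_star list \<Rightarrow> nat multiset \<Rightarrow> nat" where
  "x_mult Ss l = count (mset Ss) l"

(* The sum of x_l N(l,j) over all partitions l of height i.  There are infinitely many of
   these, and sum over an infinite set is 0 in HOL, so the range is cut down to the finitely
   many l occurring in the ensemble; x_l = 0 for all others. *)
definition label_sum :: "stub_star list \<Rightarrow> nat \<Rightarrow> nat \<Rightarrow> nat" where
  "label_sum Ss i j = (\<Sum>l | l \<in> set Ss \<and> size l = i. x_mult Ss l * count l j)"

definition chromatic_degree :: "nat \<Rightarrow> nat \<Rightarrow> stub_star \<Rightarrow> nat" where
  "chromatic_degree i j S =
     (if size S = i then count S j else if size S = j then count S i else 0)"

definition D_same :: "stub_star list \<Rightarrow> nat \<Rightarrow> nat list" where
  "D_same Ss i = map (chromatic_degree i i) Ss"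

definition D_bip :: "stub_star list \<Rightarrow> nat \<Rightarrow> nat \<Rightarrow> nat list \<times> nat list" where
  "D_bip Ss i j =
     (map (chromatic_degree i j) (filter (\<lambda>S. size S = i) Ss),
      map (chromatic_degree i j) (filter (\<lambda>S. size S = j) Ss))"

(* In the next two definitions the entry d_g of a sequence is the list element d ! (g - 1). *)

definition erdos_gallai_ineq :: "nat list \<Rightarrow> nat \<Rightarrow> bool" where
  "erdos_gallai_ineq ds k \<longleftrightarrow>
     (let d = rev (sort ds) in
       (\<Sum>g = 1..k. d ! (g - 1))
         \<le> k * (k - 1) + (\<Sum>h = k + 1..length d. min k (d ! (h - 1))))"

definition gale_ryser_ineq :: "nat list \<times> nat list \<Rightarrow> nat \<Rightarrow> bool" where
  "gale_ryser_ineq D k \<longleftrightarrow>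
     (let d1 = rev (sort (fst D)); d2 = snd D in
       (\<Sum>g = 1..k. d1 ! (g - 1)) \<le> (\<Sum>h = 1..length d2. min k (d2 ! (h - 1))))"

definition first_erdos_gallai :: "nat \<Rightarrow> nat list \<Rightarrow> bool" where
  "first_erdos_gallai r ds \<longleftrightarrow>
     (\<forall>k. 1 \<le> k \<and> k \<le> length ds \<and> k \<le> r \<longrightarrow> erdos_gallai_ineq ds k)"

definition first_gale_ryser :: "nat \<Rightarrow> nat list \<times> nat list \<Rightarrow> bool" where
  "first_gale_ryser r D \<longleftrightarrow>
     (\<forall>k. 1 \<le> k \<and> k \<le> length (fst D) \<and> k \<le> r \<longrightarrow> gale_ryser_ineq D k)"

definition balanced :: "stub_star list \<Rightarrow> bool" where
  "balanced Ss \<longleftrightarrow>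
     (\<forall>i > 0. label_sum Ss i i mod 2 = 0) \<and>
     (\<forall>i > 0. \<forall>j > 0. i \<noteq> j \<longrightarrow> label_sum Ss i j = label_sum Ss j i)"

end

theory Submission
  imports Defs
begin

text \<open>
  Colour every edge of a realization by the multiset \<open>{#i, j#}\<close> of the degrees of its two ends.
  Since the degree of a vertex must be the size of its stub-star, the colour of an edge is known
  before the graph is, and the labels of the stub-stars say exactly how many half-edges of each
  colour every vertex has. Conversely, graphs with these degrees, one for each colour, add up to a
  realization. Edges of different colours are different, so the sum has loops or parallel edges
  only if one of the summands has. Hence \<open>realizable_iff_colour_graphs\<close>: an ensemble is
  realizable if and only if each colour is, independently of the others.

  What remains are classical degree sequence problems. The colour \<open>{#i, i#}\<close> asks for a
  graph with prescribed degrees: for multigraphs the sum must be even, without loops moreover no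
  vertex may have more than half of it, and for simple graphs the condition is that of Erdos and
  Gallai. For \<open>i \<noteq> j\<close> the graph is bipartite between the vertices of degree \<open>i\<close> and
  those of degree \<open>j\<close>: both sides must have the same sum, and for simple graphs the
  Gale-Ryser condition is added.

  The multigraph cases follow by putting in one edge at a time. The sufficiency of the Erdos-Gallai
  and Gale-Ryser conditions is proved as by Tripathi, Venugopalan and West: the vertices are
  brought to their full degree in order of decreasing degree, and as long as the current vertex is
  deficient, some switch of a few edges raises its degree and spoils no finished vertex, unless
  the inequality for the current initial segment is violated. Both theorems are first
  stated for sets \<open>P\<close> of vertices of largest degree (\<open>top_part\<close>) and then
  translated to sorted sequences.

  Few inequalities suffice since a chromatic degree is at most \<open>\<Delta>\<close>. For
  \<open>k > \<Delta>\<close> the \<open>k\<close>-th Erdos-Gallai inequality holds because its left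
  side is at most \<open>k \<Delta> \<le> k (k - 1)\<close>. For \<open>k \<ge> \<Delta>\<close> the
  \<open>k\<close>-th Gale-Ryser inequality has the full sum of the second sequence on its right side,
  which equals the sum of the first.
\<close>

section \<open>Degrees and edges\<close>

lemma degree_empty [simp]: "degree {#} v = 0"
  by (simp add: degree_def)

lemma degree_add [simp]: "degree (add_mset e E) v = count e v + degree E v"
  by (simp add: degree_def)

lemma degree_eq_0_iff: "degree E v = 0 \<longleftrightarrow> (\<forall>e\<in>#E. v \<notin># e)"
  by (induction E) (auto simp: not_in_iff)

lemma pair_mset_eq_iff: "{#a, b#} = {#c, d#} \<longleftrightarrow> (a = c \<and> b = d) \<or> (a = d \<and> b = c)"
  by (auto simp: add_eq_conv_ex)

lemma edge_pair:
  assumes "multigraph V E" "e \<in># E"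
  obtains a b where "a \<in> V" "b \<in> V" "e = {#a, b#}"
proof -
  have e: "size e = Suc (Suc 0)" "set_mset e \<subseteq> V"
    using assms by (auto simp: multigraph_def numeral_2_eq_2)
  obtain a M where M: "e = add_mset a M"
    using size_eq_Suc_imp_eq_union[OF e(1)] by blast
  with e(1) have "size M = 1" by simp
  from size_1_singleton_mset[OF this] obtain b where "M = {#b#}" by blast
  with M e(2) that show thesis by auto
qed

lemma multigraph_add:
  "multigraph V (add_mset e E) \<longleftrightarrow> size e = 2 \<and> set_mset e \<subseteq> V \<and> multigraph V E"
  by (auto simp: multigraph_def)

lemma loopless_multigraph_add:
  "loopless_multigraph V (add_mset {#a, b#} E) \<longleftrightarrow>
     a \<in> V \<and> b \<in> V \<and> a \<noteq> b \<and> loopless_multigraph V E"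
  by (auto simp: loopless_multigraph_def multigraph_add pair_mset_eq_iff)

lemma simple_graph_add:
  "simple_graph V (add_mset {#a, b#} E) \<longleftrightarrow>
     a \<in> V \<and> b \<in> V \<and> a \<noteq> b \<and> {#a, b#} \<notin># E \<and> simple_graph V E"
proof -
  have "(\<forall>e. count (add_mset x E) e \<le> 1) \<longleftrightarrow> x \<notin># E \<and> (\<forall>e. count E e \<le> 1)" for x
  proof (intro iffI conjI allI)
    assume *: "\<forall>e. count (add_mset x E) e \<le> 1"
    show "x \<notin># E" using *[rule_format, of x] by (simp add: not_in_iff)
    show "count E e \<le> 1" for e
      using *[rule_format, of e] by (simp split: if_splits)
  qed (auto simp: not_in_iff)
  then show ?thesis
    by (auto simp: simple_graph_def loopless_multigraph_add)
qed

lemma graph_empty [simp]: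
  "multigraph V {#}" "loopless_multigraph V {#}" "simple_graph V {#}"
  by (auto simp: multigraph_def loopless_multigraph_def simple_graph_def)

lemma sum_count_eq_size:
  assumes "finite V" "set_mset e \<subseteq> V"
  shows "(\<Sum>v\<in>V. count e v) = size e"
  unfolding size_multiset_overloaded_eq
  using assms by (intro sum.mono_neutral_right) (auto simp: not_in_iff)

lemma handshake:
  assumes "finite V" "multigraph V E"
  shows "(\<Sum>v\<in>V. degree E v) = 2 * size E"
  using assms(2)
  by (induction E) (auto simp: multigraph_add sum.distrib sum_count_eq_size[OF assms(1)])

lemma loopless_degree_le_size:
  assumes "loopless_multigraph V E"
  shows "degree E v \<le> size E"
  using assms
proof (induction E)
  case (add e E)
  have "multigraph V (add_mset e E)" using add.prems by (simp add: loopless_multigraph_def)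
  then obtain a b where e: "e = {#a, b#}" by (rule edge_pair[of _ _ e]) auto
  with add show ?case by (auto simp: loopless_multigraph_add)
qed simp

section \<open>Splitting a realization by colours\<close>

text \<open>
  The colours are arbitrary here; in the application \<open>t v\<close> is the size of the stub-star at
  \<open>v\<close>, that is, the degree that \<open>v\<close> is going to have.
\<close>

definition colour_class :: "('v \<Rightarrow> 'c) \<Rightarrow> 'c multiset \<Rightarrow> 'v multiset multiset \<Rightarrow> 'v multiset multiset"
  where "colour_class t c E = filter_mset (\<lambda>e. image_mset t e = c) E"

lemma count_neighbours_eq_degree:
  assumes "multigraph V E"
  shows "count (image_mset t (neighbours E v)) j = degree (colour_class t {#t v, j#} E) v"
  using assms
proof (induction E)
  case (add e E)
  obtain a b where "e = {#a, b#}" by (rule edge_pair[OF add.prems, of e]) auto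
  with add show ?case
    by (auto simp: neighbours_def colour_class_def multigraph_add pair_mset_eq_iff)
qed (simp_all add: neighbours_def colour_class_def)

lemma degree_eq_size_neighbours:
  assumes "multigraph V E"
  shows "degree E v = size (neighbours E v)"
  using assms
proof (induction E)
  case (add e E)
  obtain a b where "e = {#a, b#}" by (rule edge_pair[OF add.prems, of e]) auto
  with add show ?case by (auto simp: neighbours_def multigraph_add)
qed (simp_all add: neighbours_def)

lemma neighbours_subset:
  assumes "multigraph V E"
  shows "set_mset (neighbours E v) \<subseteq> V"
proof -
  have "set_mset (repeat_mset k M) \<subseteq> set_mset M" for k and M :: "'a multiset"
    by (induction k) auto
  then have "set_mset (repeat_mset k (e - {#v#})) \<subseteq> V" if "e \<in># E" for e k
    using that assms by (fastforce simp: multigraph_def dest: in_diffD)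
  then show ?thesis by (auto simp: neighbours_def)
qed

text \<open>
  The definition of a realization refers to the degrees in the graph itself. They may be replaced
  by the sizes of the stub-stars: either condition determines the number of neighbours of a vertex,
  and thus its degree. After that, both sides count half-edges by the colour of their edge.
\<close>

lemma realization_iff_colour_degrees:
  assumes "multigraph V E"
  shows "(\<forall>v\<in>V. image_mset (degree E) (neighbours E v) = S v) \<longleftrightarrow>
    (\<forall>v\<in>V. \<forall>j. degree (colour_class (\<lambda>v. size (S v)) {#size (S v), j#} E) v = count (S v) j)"
    (is "?L \<longleftrightarrow> ?R")
proof -
  let ?t = "\<lambda>v. size (S v)"
  have R: "?R \<longleftrightarrow> (\<forall>v\<in>V. image_mset ?t (neighbours E v) = S v)"
    by (simp add: multiset_eq_iff[of "image_mset _ _"] count_neighbours_eq_degree[OF assms])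
  have same: "image_mset (degree E) (neighbours E v) = image_mset ?t (neighbours E v)"
    if "\<forall>v\<in>V. degree E v = ?t v" for v
    using that neighbours_subset[OF assms] by (intro image_mset_cong) auto
  have "\<forall>v\<in>V. degree E v = ?t v" if "\<forall>v\<in>V. image_mset f (neighbours E v) = S v" for f
    using that by (metis degree_eq_size_neighbours[OF assms] size_image_mset)
  with R same show ?thesis by metis
qed

lemma colour_class_sum:
  assumes "finite K" "\<And>c e. c \<in> K \<Longrightarrow> e \<in># G c \<Longrightarrow> image_mset t e = c"
  shows "colour_class t c (\<Sum>c\<in>K. G c) = (if c \<in> K then G c else {#})"
  using assms
proof (induction K)
  case (insert x K)
  have "filter_mset (\<lambda>e. image_mset t e = c) (G x) = (if x = c then G x else {#})"
    using insert.prems[of x] by (auto simp: filter_mset_eq_conv)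
  with insert show ?case by (auto simp: colour_class_def)
qed (simp add: colour_class_def)

lemma chromatic_degree_commute: "chromatic_degree i j S = chromatic_degree j i S"
  by (simp add: chromatic_degree_def)

definition colour_graph :: "('v \<Rightarrow> stub_star) \<Rightarrow> 'v set \<Rightarrow> nat \<Rightarrow> nat \<Rightarrow> 'v multiset multiset \<Rightarrow> bool"
  where "colour_graph S V i j F \<longleftrightarrow>
    (\<forall>e\<in>#F. image_mset (\<lambda>v. size (S v)) e = {#i, j#}) \<and>
    (\<forall>v\<in>V. degree F v = chromatic_degree i j (S v))"

lemma colour_graph_commute: "colour_graph S V i j = colour_graph S V j i"
  by (simp add: colour_graph_def chromatic_degree_commute add_mset_commute fun_eq_iff)

text \<open>
  \<open>Q\<close> stands for any of the three kinds of graphs; the last assumption says that loops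
  and parallel edges are detected within the colour classes. Colours involving 0 are left out,
  since a vertex of degree 0 has no half-edge and no label is 0.
\<close>

lemma realizable_iff_colour_graphs:
  fixes S :: "'v \<Rightarrow> stub_star"
  defines "t \<equiv> \<lambda>v. size (S v)"
  assumes fin: "finite V" and part: "\<And>v. v \<in> V \<Longrightarrow> is_partition (S v)"
    and Qm: "\<And>E. Q E \<Longrightarrow> multigraph V E" and Q0: "Q {#}"
    and Qc: "\<And>E. Q E \<longleftrightarrow> (\<forall>c. Q (colour_class t c E))"
  shows "(\<exists>E. Q E \<and> (\<forall>v\<in>V. image_mset (degree E) (neighbours E v) = S v)) \<longleftrightarrow>
    (\<forall>i>0. \<forall>j>0. \<exists>F. Q F \<and> colour_graph S V i j F)"
proof (intro iffI allI impI)
  fix i j :: nat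
  assume "\<exists>E. Q E \<and> (\<forall>v\<in>V. image_mset (degree E) (neighbours E v) = S v)"
  then obtain E where E: "Q E" "\<And>v. v \<in> V \<Longrightarrow> image_mset (degree E) (neighbours E v) = S v"
    by blast
  then have deg: "\<And>v k. v \<in> V \<Longrightarrow> degree (colour_class t {#t v, k#} E) v = count (S v) k"
    using realization_iff_colour_degrees[OF Qm[OF E(1)], of S] by (simp add: t_def)
  have "degree (colour_class t {#i, j#} E) v = chromatic_degree i j (S v)" if "v \<in> V" for v
  proof -
    consider "t v = i" | "t v \<noteq> i" "t v = j" | "t v \<noteq> i" "t v \<noteq> j" by blast
    then show ?thesis
    proof cases
      case 3
      then have "v \<notin># e" if "image_mset t e = {#i, j#}" for e
        using that by (metis image_eqI in_image_mset insert_iff set_mset_add_mset_insert set_mset_empty empty_iff)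
      then have "degree (colour_class t {#i, j#} E) v = 0"
        by (auto simp: degree_eq_0_iff colour_class_def)
      with 3 show ?thesis by (simp add: chromatic_degree_def t_def)
    qed (use deg[OF that] in \<open>auto simp: chromatic_degree_def t_def add_mset_commute\<close>)
  qed
  then have "colour_graph S V i j (colour_class t {#i, j#} E)"
    by (simp add: colour_graph_def) (simp add: colour_class_def t_def)
  with Qc E(1) show "\<exists>F. Q F \<and> colour_graph S V i j F" by blast
next
  assume R: "\<forall>i>0. \<forall>j>0. \<exists>F. Q F \<and> colour_graph S V i j F"
  \<comment> \<open>Only finitely many colours occur. A colour with a label that is no degree of a stub-star has
      to be kept: that its graph exists at all forces the number of these labels to be 0.\<close>
  define L where "L = (\<Union>v\<in>V. insert (t v) (set_mset (S v))) - {0}"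
  define K where "K = (\<lambda>(i, j). {#i, j#}) ` (L \<times> L)"
  define good where "good = (\<lambda>c F. Q F \<and> (\<forall>i j. c = {#i, j#} \<longrightarrow> colour_graph S V i j F))"
  have "\<exists>F. good c F" if c: "c \<in> K" for c
  proof -
    obtain i j where ij: "c = {#i, j#}" "i > 0" "j > 0"
      using c by (auto simp: K_def L_def)
    with R obtain F where F: "Q F" "colour_graph S V i j F" by blast
    then have "good c F"
      by (auto simp: good_def ij pair_mset_eq_iff colour_graph_commute)
    then show ?thesis ..
  qed
  then obtain G where G: "\<And>c. c \<in> K \<Longrightarrow> good c (G c)" by metis
  have GQ: "Q (G c)" and Gc: "\<forall>i j. c = {#i, j#} \<longrightarrow> colour_graph S V i j (G c)" if "c \<in> K" for c
    using G[OF that] by (auto simp: good_def)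
  define E where "E = (\<Sum>c\<in>K. G c)"
  have "finite K" using fin by (auto simp: K_def L_def)
  moreover have "image_mset t e = c" if c: "c \<in> K" "e \<in># G c" for c e
  proof -
    obtain i j where "c = {#i, j#}" using c(1) by (auto simp: K_def)
    with Gc c show ?thesis by (auto simp: colour_graph_def t_def)
  qed
  ultimately have cc: "colour_class t c E = (if c \<in> K then G c else {#})" for c
    unfolding E_def by (rule colour_class_sum)
  then have QE: "Q E" using GQ Q0 Qc[of E] by auto
  have "degree (colour_class t {#t v, j#} E) v = count (S v) j" if v: "v \<in> V" for v j
  proof (cases "{#t v, j#} \<in> K")
    case True
    then have "degree (G {#t v, j#}) v = chromatic_degree (t v) j (S v)"
      using Gc[OF True] v by (auto simp: colour_graph_def)
    with True show ?thesis by (simp add: cc) (simp add: chromatic_degree_def t_def)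
  next
    case False
    have "j \<notin># S v"
    proof
      assume j: "j \<in># S v"
      then have "j > 0" "t v > 0"
        using part[OF v] by (auto simp: is_partition_def t_def nonempty_has_size[symmetric])
      then have "t v \<in> L" "j \<in> L" using j v by (auto simp: L_def)
      with False show False by (auto simp: K_def)
    qed
    with False show ?thesis by (simp add: cc not_in_iff)
  qed
  then have "\<forall>v\<in>V. image_mset (degree E) (neighbours E v) = S v"
    using realization_iff_colour_degrees[OF Qm[OF QE], of S] by (simp add: t_def)
  with QE show "\<exists>E. Q E \<and> (\<forall>v\<in>V. image_mset (degree E) (neighbours E v) = S v)" by blast
qed

lemma graph_class_by_colours:
  "multigraph V E \<longleftrightarrow> (\<forall>c. multigraph V (colour_class t c E))"
  "loopless_multigraph V E \<longleftrightarrow> (\<forall>c. loopless_multigraph V (colour_class t c E))"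
  "simple_graph V E \<longleftrightarrow> (\<forall>c. simple_graph V (colour_class t c E))"
  by (simp add: multigraph_def loopless_multigraph_def simple_graph_def colour_class_def, blast)+

section \<open>Prescribed degrees in multigraphs\<close>

lemma peel_degrees:
  fixes d :: "'v \<Rightarrow> nat"
  assumes "finite V" "set_mset e \<subseteq> V" "size e = 2" "\<And>v. v \<in> V \<Longrightarrow> count e v \<le> d v"
  shows "(\<Sum>v\<in>V. d v - count e v) + 2 = sum d V" (is "?s + 2 = _")
    and "(\<Sum>v\<in>V. d v - count e v) < sum d V"
    and "even (\<Sum>v\<in>V. d v - count e v) \<longleftrightarrow> even (sum d V)"
proof -
  have "sum d V = (\<Sum>v\<in>V. (d v - count e v) + count e v)"
    using assms(4) by (intro sum.cong) auto
  also have "\<dots> = (\<Sum>v\<in>V. d v - count e v) + size e"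
    by (simp only: sum.distrib sum_count_eq_size[OF assms(1,2)])
  finally show eq: "?s + 2 = sum d V" using assms(3) by simp
  show "?s < sum d V" using eq by linarith
  show "even ?s \<longleftrightarrow> even (sum d V)" unfolding eq[symmetric] even_add by simp
qed

text \<open>
  A vertex that lacks at least two half-edges takes a loop. If it lacks only one, some other vertex is
  deficient as well, because the sum is even.
\<close>

lemma multigraph_with_degrees:
  fixes d :: "'v \<Rightarrow> nat"
  assumes "finite V" "even (sum d V)"
  shows "\<exists>E. multigraph V E \<and> (\<forall>v\<in>V. degree E v = d v)"
  using assms(2)
proof (induction "sum d V" arbitrary: d rule: less_induct)
  case (less d)
  show ?case
  proof (cases "\<exists>u\<in>V. d u > 0")
    case False
    then show ?thesis by (intro exI[of _ "{#}"]) auto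
  next
    case True
    then obtain u where u: "u \<in> V" "d u > 0" by blast
    have "\<exists>w\<in>V. \<forall>v\<in>V. count {#u, w#} v \<le> d v"
    proof (cases "d u = 1")
      case True
      have "sum d V = d u + sum d (V - {u})" by (rule sum.remove[OF assms(1) u(1)])
      with less.prems True have "sum d (V - {u}) \<noteq> 0" by (auto intro: ccontr)
      then obtain w where "w \<in> V - {u}" "d w > 0" by (metis neq0_conv sum.neutral)
      with u show ?thesis by (intro bexI[of _ w]) auto
    next
      case False
      with u show ?thesis by (intro bexI[of _ u]) auto
    qed
    then obtain w where w: "w \<in> V" "\<And>v. v \<in> V \<Longrightarrow> count {#u, w#} v \<le> d v" by blast
    let ?d = "\<lambda>v. d v - count {#u, w#} v"
    have uw: "set_mset {#u, w#} \<subseteq> V" "size {#u, w#} = 2" using u w by auto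
    note peel = peel_degrees[OF assms(1) uw w(2)]
    have "even (sum ?d V)" using peel(3) less.prems by blast
    with peel(2) obtain E where "multigraph V E" "\<forall>v\<in>V. degree E v = ?d v"
      using less.hyps[of ?d] by blast
    then show ?thesis
      using u w by (intro exI[of _ "add_mset {#u, w#} E"]) (auto simp: multigraph_add)
  qed
qed

lemma finite_maximizer:
  fixes f :: "'a \<Rightarrow> 'b::linorder"
  assumes "finite X" "X \<noteq> {}"
  shows "\<exists>u\<in>X. \<forall>v\<in>X. f v \<le> f u"
proof -
  have "Max (f ` X) \<in> f ` X" using assms by simp
  then obtain u where "u \<in> X" "Max (f ` X) = f u" by blast
  then show ?thesis using Max_ge[of "f ` X"] assms(1) by (metis finite_imageI imageI)
qed

text \<open>
  Joining the two vertices of largest remaining degree preserves the condition that no vertex has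
  more than half of the sum.
\<close>

lemma loopless_multigraph_with_degrees:
  fixes d :: "'v \<Rightarrow> nat"
  assumes "finite V" "even (sum d V)" "\<And>v. v \<in> V \<Longrightarrow> 2 * d v \<le> sum d V"
  shows "\<exists>E. loopless_multigraph V E \<and> (\<forall>v\<in>V. degree E v = d v)"
  using assms(2,3)
proof (induction "sum d V" arbitrary: d rule: less_induct)
  case (less d)
  show ?case
  proof (cases "\<exists>u\<in>V. d u > 0")
    case False
    then show ?thesis by (intro exI[of _ "{#}"]) auto
  next
    case True
    obtain u where u: "u \<in> V" "\<And>v. v \<in> V \<Longrightarrow> d v \<le> d u"
      using finite_maximizer[OF assms(1), of d] True by blast
    then have du: "d u > 0" using True by (metis less_le_trans)
    have rem: "sum d V = d u + sum d (V - {u})" by (rule sum.remove[OF assms(1) u(1)])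
    with less.prems(2)[OF u(1)] du have "sum d (V - {u}) \<noteq> 0" by linarith
    then obtain x where x: "x \<in> V - {u}" "d x > 0" by (metis neq0_conv sum.neutral)
    obtain w where w: "w \<in> V - {u}" "\<And>v. v \<in> V - {u} \<Longrightarrow> d v \<le> d w"
      using finite_maximizer[of "V - {u}" d] x assms(1) by blast
    then have dw: "d w > 0" using x by (metis less_le_trans)
    let ?d = "\<lambda>v. d v - count {#u, w#} v"
    have cnt: "count {#u, w#} v \<le> d v" if "v \<in> V" for v using w du dw by auto
    have uw: "set_mset {#u, w#} \<subseteq> V" "size {#u, w#} = 2" using u w by auto
    note peel = peel_degrees[OF assms(1) uw cnt]
    have ev: "even (sum ?d V)" using peel(3) less.prems(1) by blast
    note sum = peel(1) and less' = peel(2)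
    have "2 * ?d v \<le> sum ?d V" if v: "v \<in> V" for v
    proof (cases "v = u \<or> v = w")
      case True
      with less.prems(2)[OF v] sum w show ?thesis by auto
    next
      case False
      \<comment> \<open>The vertices u, w and v alone account for 3 d(v) half-edges; if d(v) = 1 the
          missing one comes from the parity of the sum.\<close>
      have "sum d {u, w, v} \<le> sum d V"
        using u(1) w(1) v assms(1) by (intro sum_mono2) auto
      then have "d u + d w + d v \<le> sum d V" using False w(1) by auto
      moreover have "d v \<le> d w" "d w \<le> d u" using w u v False by auto
      moreover have "?d v = d v" using False by auto
      moreover have "sum d V \<noteq> 3" using less.prems by auto
      ultimately show ?thesis using sum less.prems by (cases "d v = 1") linarith+
    qed
    with less.hyps[OF less' ev] obtain E
      where "loopless_multigraph V E" "\<forall>v\<in>V. degree E v = ?d v" by blast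
    then show ?thesis
      using u w du dw by (intro exI[of _ "add_mset {#u, w#} E"]) (auto simp: loopless_multigraph_add)
  qed
qed

definition between :: "'v set \<Rightarrow> 'v set \<Rightarrow> 'v multiset multiset \<Rightarrow> bool"
  where "between A B E \<longleftrightarrow> (\<forall>e\<in>#E. \<exists>a\<in>A. \<exists>b\<in>B. e = {#a, b#})"

lemma between_sum_degree:
  assumes "between A B E" "A \<inter> B = {}" "finite A"
  shows "(\<Sum>a\<in>A. degree E a) = size E"
  using assms(1)
proof (induction E)
  case (add e E)
  then obtain a b where ab: "a \<in> A" "b \<in> B" "e = {#a, b#}" "between A B E"
    by (auto simp: between_def)
  then have "count e x = (if x = a then 1 else 0)" if "x \<in> A" for x
    using that assms(2) by auto
  then have "(\<Sum>x\<in>A. count e x) = 1" using ab(1) assms(3) by simp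
  with add ab(4) show ?case by (simp add: sum.distrib)
qed simp

lemma between_commute: "between A B E \<longleftrightarrow> between B A E"
  unfolding between_def by (metis add_mset_commute)

lemma between_loopless:
  assumes "between A B E" "A \<inter> B = {}" "A \<union> B \<subseteq> V"
  shows "loopless_multigraph V E"
  using assms by (fastforce simp: between_def loopless_multigraph_def multigraph_def pair_mset_eq_iff)

text \<open>
  As long as the common sum is positive, both sides have a vertex that still needs an edge.
\<close>

lemma bipartite_multigraph_with_degrees:
  fixes d :: "'v \<Rightarrow> nat"
  assumes "finite A" "finite B" "A \<inter> B = {}" "sum d A = sum d B"
  shows "\<exists>E. between A B E \<and> (\<forall>v\<in>A \<union> B. degree E v = d v)"
  using assms(4)
proof (induction "sum d A" arbitrary: d)
  case 0
  then have "\<forall>v\<in>A \<union> B. d v = 0" using assms by (metis Un_iff sum_eq_0_iff)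
  then show ?case by (intro exI[of _ "{#}"]) (auto simp: between_def)
next
  case (Suc n)
  then obtain a b where ab: "a \<in> A" "d a > 0" "b \<in> B" "d b > 0"
    by (metis neq0_conv sum.neutral nat.distinct(1))
  let ?d = "\<lambda>v. d v - count {#a, b#} v"
  have "sum ?d A = sum d A - 1" "sum ?d B = sum d B - 1"
  proof -
    have *: "sum ?d X = sum d X - 1" if X: "finite X" "x \<in> X" "d x > 0"
      "\<forall>v\<in>X. count {#a, b#} v = (if v = x then 1 else 0)" for X x
    proof -
      have "sum ?d X = ?d x + sum ?d (X - {x})" by (rule sum.remove) (use X in auto)
      also have "sum ?d (X - {x}) = sum d (X - {x})" using X by (intro sum.cong) auto
      finally show ?thesis using X sum.remove[of X x d] by auto
    qed
    show "sum ?d A = sum d A - 1" by (rule *[of A a]) (use ab assms in auto)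
    show "sum ?d B = sum d B - 1" by (rule *[of B b]) (use ab assms in auto)
  qed
  then have "n = sum ?d A" "sum ?d A = sum ?d B" using Suc by linarith+
  then obtain E where "between A B E" "\<forall>v\<in>A \<union> B. degree E v = ?d v"
    using Suc.hyps(1)[of ?d] by blast
  with ab assms(3) show ?case
    by (intro exI[of _ "add_mset {#a, b#} E"]) (auto simp: between_def)
qed

section \<open>Neighbourhoods and switches in simple graphs\<close>

definition adjacent :: "'v multiset multiset \<Rightarrow> 'v \<Rightarrow> 'v set"
  where "adjacent E v = {u. {#u, v#} \<in># E}"

lemma adjacent_sym: "u \<in> adjacent E v \<longleftrightarrow> v \<in> adjacent E u"
  by (simp add: adjacent_def add_mset_commute)

lemma finite_adjacent [simp]: "finite (adjacent E v)"
proof (rule finite_subset)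
  show "adjacent E v \<subseteq> (\<Union>e\<in>set_mset E. set_mset e)"
  proof
    fix u assume "u \<in> adjacent E v"
    then show "u \<in> (\<Union>e\<in>set_mset E. set_mset e)"
      by (intro UN_I[of "{#u, v#}"]) (auto simp: adjacent_def)
  qed
qed auto

lemma simple_graphD:
  assumes "simple_graph V E" "u \<in> adjacent E v"
  shows "u \<in> V" "v \<in> V" "u \<noteq> v"
proof -
  have uv: "{#u, v#} \<in># E" using assms(2) by (simp add: adjacent_def)
  with assms(1) have "set_mset {#u, v#} \<subseteq> V"
    unfolding simple_graph_def loopless_multigraph_def multigraph_def by blast
  then show "u \<in> V" "v \<in> V" by auto
  show "u \<noteq> v"
    using uv assms(1) by (auto simp: simple_graph_def loopless_multigraph_def)
qed

lemma simple_graph_multigraph: "simple_graph V E \<Longrightarrow> multigraph V E"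
  by (simp add: simple_graph_def loopless_multigraph_def)

lemma simple_graph_removeE:
  assumes "simple_graph V E" "u \<in> adjacent E v"
  obtains E0 where "E = add_mset {#u, v#} E0" "u \<in> V" "v \<in> V" "u \<noteq> v"
    "{#u, v#} \<notin># E0" "simple_graph V E0"
proof -
  obtain E0 where E0: "E = add_mset {#u, v#} E0"
    using assms(2) by (auto simp: adjacent_def dest: mset_add)
  with assms(1) have "simple_graph V (add_mset {#u, v#} E0)" by simp
  with E0 that show thesis unfolding simple_graph_add by blast
qed

lemma degree_eq_card_adjacent:
  assumes "simple_graph V E"
  shows "degree E v = card (adjacent E v)"
  using assms
proof (induction E)
  case (add e E)
  obtain a b where e: "e = {#a, b#}"
    by (rule edge_pair[OF simple_graph_multigraph[OF add.prems], of e]) auto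
  have ab: "a \<noteq> b" "{#a, b#} \<notin># E" "simple_graph V E"
    using add.prems by (auto simp: e simple_graph_add)
  have "adjacent (add_mset e E) v =
    (if v = a then insert b (adjacent E v) else if v = b then insert a (adjacent E v)
     else adjacent E v)"
    using ab(1) by (auto simp: adjacent_def e pair_mset_eq_iff)
  moreover have "b \<notin> adjacent E a" "a \<notin> adjacent E b"
    using ab(2) by (auto simp: adjacent_def add_mset_commute)
  ultimately show ?case using add.IH[OF ab(3)] ab(1) by (auto simp: e)
qed (simp add: adjacent_def)

text \<open>
  This supplies every switch below: the edge from \<open>x\<close> to \<open>u\<close> can be traded for
  one from \<open>y\<close> to \<open>u\<close>. It exists because \<open>x\<close> has more neighbours than
  \<open>y\<close>, also after \<open>x\<close> and \<open>y\<close> are removed from these neighbourhoods: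
  if they are adjacent, each neighbourhood loses one element.
\<close>

lemma exchange_neighbour:
  assumes "simple_graph V E" "degree E y < degree E x"
  obtains u where "u \<in> adjacent E x" "u \<notin> adjacent E y" "u \<noteq> y"
proof (rule ccontr)
  assume "\<not> thesis"
  with that have "adjacent E x - {y} \<subseteq> adjacent E y - {x}"
    using simple_graphD(3)[OF assms(1)] by blast
  then have "card (adjacent E x - {y}) \<le> card (adjacent E y - {x})"
    by (intro card_mono) auto
  then have "card (adjacent E x) \<le> card (adjacent E y)"
    using adjacent_sym[of x E y] card_Suc_Diff1[of "adjacent E x" y]
      card_Suc_Diff1[of "adjacent E y" x]
    by (cases "y \<in> adjacent E x") auto
  with assms(2) show False
    by (simp add: degree_eq_card_adjacent[OF assms(1)])
qed

lemma sum_card_swap: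
  assumes "finite X" "finite Y"
  shows "(\<Sum>x\<in>X. card {y \<in> Y. R x y}) = (\<Sum>y\<in>Y. card {x \<in> X. R x y})"
  using sum.swap_restrict[OF assms, of "\<lambda>_ _. 1::nat" R] by simp

text \<open>
  The half-edges at \<open>P\<close> are those of edges inside \<open>P\<close>, and one for each edge
  leaving \<open>P\<close>, which is counted at its other end. The necessity proofs bound these two
  sums, and the sufficiency proof for Erdos-Gallai evaluates them.
\<close>

lemma sum_degree_split:
  assumes "finite V" "simple_graph V E" "P \<subseteq> V"
  shows "(\<Sum>x\<in>P. degree E x) =
    (\<Sum>x\<in>P. card (adjacent E x \<inter> P)) + (\<Sum>u\<in>V - P. card (adjacent E u \<inter> P))"
proof -
  have "degree E x = card (adjacent E x \<inter> P) + card (adjacent E x \<inter> (V - P))" for x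
  proof -
    have "adjacent E x = adjacent E x \<inter> P \<union> adjacent E x \<inter> (V - P)"
      using simple_graphD(1)[OF assms(2)] by blast
    then have "card (adjacent E x) = card (adjacent E x \<inter> P \<union> adjacent E x \<inter> (V - P))"
      by simp
    also have "\<dots> = card (adjacent E x \<inter> P) + card (adjacent E x \<inter> (V - P))"
      by (intro card_Un_disjoint) auto
    finally show ?thesis by (simp add: degree_eq_card_adjacent[OF assms(2)])
  qed
  moreover have "(\<Sum>x\<in>P. card (adjacent E x \<inter> (V - P))) = (\<Sum>u\<in>V - P. card (adjacent E u \<inter> P))"
  proof -
    have "(\<Sum>x\<in>P. card {u \<in> V - P. u \<in> adjacent E x}) = (\<Sum>u\<in>V - P. card {x \<in> P. u \<in> adjacent E x})"
      by (intro sum_card_swap) (use assms finite_subset in auto)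
    moreover have "{u \<in> V - P. u \<in> adjacent E x} = adjacent E x \<inter> (V - P)" for x by auto
    moreover have "{x \<in> P. u \<in> adjacent E x} = adjacent E u \<inter> P" for u
      using adjacent_sym[of u E] by auto
    ultimately show ?thesis by simp
  qed
  ultimately show ?thesis by (simp add: sum.distrib)
qed

section \<open>Growing a set of largest degrees\<close>

text \<open>
  The sets that can be the first \<open>card P\<close> members of \<open>A\<close> in an enumeration by
  decreasing \<open>f\<close>. They allow to work with vertices, without choosing an enumeration.
\<close>

definition top_part :: "('a \<Rightarrow> nat) \<Rightarrow> 'a set \<Rightarrow> 'a set \<Rightarrow> bool"
  where "top_part f A P \<longleftrightarrow> P \<subseteq> A \<and> (\<forall>p\<in>P. \<forall>q\<in>A - P. f q \<le> f p)"

text \<open>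
  Induction along an enumeration by decreasing \<open>f\<close>: the next element is one that maximizes
  \<open>f\<close> outside \<open>P\<close>.
\<close>

lemma top_part_chain:
  assumes "finite A" "n \<le> card A" "Q {}"
    and step: "\<And>P v. \<lbrakk>top_part f A (insert v P); v \<in> A - P; \<forall>p\<in>P. f v \<le> f p; Q P\<rbrakk>
      \<Longrightarrow> Q (insert v P)"
  shows "\<exists>P. top_part f A P \<and> card P = n \<and> Q P"
  using assms(2)
proof (induction n)
  case 0
  have "top_part f A {} \<and> card {} = 0 \<and> Q {}" using assms(3) by (simp add: top_part_def)
  then show ?case by blast
next
  case (Suc n)
  then obtain P where P: "top_part f A P" "card P = n" "Q P" by auto
  then have "P \<subseteq> A" by (simp add: top_part_def)
  then have "finite P" using assms(1) by (rule finite_subset)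
  have "A - P \<noteq> {}" using P(2) Suc.prems \<open>P \<subseteq> A\<close> by auto
  then obtain v where v: "v \<in> A - P" "\<forall>q\<in>A - P. f q \<le> f v"
    using finite_maximizer[of "A - P" f] assms(1) by auto
  with P(1) have "top_part f A (insert v P)" "\<forall>p\<in>P. f v \<le> f p"
    by (auto simp: top_part_def)
  with v step P(3) \<open>finite P\<close> P(2) show ?case
    by (intro exI[of _ "insert v P"]) auto
qed

corollary top_part_exists:
  assumes "finite A" "n \<le> card A"
  shows "\<exists>P. top_part f A P \<and> card P = n"
  using top_part_chain[OF assms, of "\<lambda>_. True"] by auto

section \<open>Gale-Ryser\<close>

text \<open>
  The vertices in \<open>P\<close> are finished, and those in \<open>A - R\<close> are still isolated. Either
  \<open>R\<close> is \<open>P\<close>, or \<open>R\<close> also contains the vertex that is being treated.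
\<close>

definition bipartite_partial_realization ::
    "'v set \<Rightarrow> 'v set \<Rightarrow> ('v \<Rightarrow> nat) \<Rightarrow> 'v set \<Rightarrow> 'v set \<Rightarrow> 'v multiset multiset \<Rightarrow> bool"
  where "bipartite_partial_realization A B d P R E \<longleftrightarrow> simple_graph (A \<union> B) E \<and> between R B E \<and>
    (\<forall>u\<in>R \<union> B. degree E u \<le> d u) \<and> (\<forall>p\<in>P. degree E p = d p)"

text \<open>
  If every vertex of \<open>B\<close> had at least degree \<open>min (card (insert v P)) (d u)\<close>, then
  the number of edges would contradict the inequality for \<open>insert v P\<close>. So some vertex
  \<open>k\<close> of \<open>B\<close> can take another edge and misses some vertex of
  \<open>insert v P\<close>. If it misses \<open>v\<close>, join the two; otherwise it misses a finished
  vertex \<open>i\<close>, which takes \<open>k\<close> as a neighbour and cedes one of its own to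
  \<open>v\<close>.
\<close>

lemma gale_ryser_step:
  fixes A B P :: "'v set" and d :: "'v \<Rightarrow> nat" and v :: 'v
  defines "stage \<equiv> bipartite_partial_realization A B d P (insert v P)"
  assumes fin: "finite A" "finite B" "A \<inter> B = {}" "insert v P \<subseteq> A" "v \<notin> P"
    and le: "\<forall>p\<in>P. d v \<le> d p"
    and GR: "sum d (insert v P) \<le> (\<Sum>u\<in>B. min (card (insert v P)) (d u))"
    and E: "stage E" and less: "degree E v < d v"
  shows "\<exists>E'. stage E' \<and> degree E v < degree E' v"
proof -
  have finP: "finite (insert v P)" using fin(4,1) by (rule finite_subset)
  have st: "simple_graph (A \<union> B) E" "between (insert v P) B E"
    "\<And>u. u \<in> insert v P \<union> B \<Longrightarrow> degree E u \<le> d u" "\<And>p. p \<in> P \<Longrightarrow> degree E p = d p"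
    using E unfolding stage_def bipartite_partial_realization_def by blast+
  have nb: "u \<in> B \<and> x \<in> insert v P \<or> x \<in> B \<and> u \<in> insert v P" if ux: "u \<in> adjacent E x" for u x
  proof -
    obtain a b where "a \<in> insert v P" "b \<in> B" "{#u, x#} = {#a, b#}"
      using ux st(2) unfolding between_def adjacent_def by blast
    then show ?thesis unfolding pair_mset_eq_iff by blast
  qed
  have "\<exists>k\<in>B. degree E k < min (card (insert v P)) (d k)"
  proof (rule ccontr)
    assume "\<not> ?thesis"
    then have "(\<Sum>u\<in>B. min (card (insert v P)) (d u)) \<le> (\<Sum>u\<in>B. degree E u)"
      by (intro sum_mono) (meson not_le)
    also have "\<dots> = size E"
      using st(2) fin by (intro between_sum_degree[of B "insert v P"]) (auto simp: between_commute)
    also have "\<dots> = (\<Sum>p\<in>insert v P. degree E p)"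
      using st(2) fin finP by (intro between_sum_degree[symmetric]) auto
    also have "\<dots> < sum d (insert v P)"
      using finP st(3) less by (intro sum_strict_mono_ex1) auto
    finally show False using GR by simp
  qed
  then obtain k where k: "k \<in> B" "degree E k < card (insert v P)" "degree E k < d k" by auto
  have kP: "k \<notin> insert v P" using k fin by blast
  show ?thesis
  proof (cases "k \<in> adjacent E v")
    case False
    have "stage (add_mset {#v, k#} E)"
      unfolding stage_def bipartite_partial_realization_def simple_graph_add
      using False st k kP fin less
      by (auto simp: between_def adjacent_def add_mset_commute Suc_le_eq)
    then show ?thesis by (intro exI[of _ "add_mset {#v, k#} E"]) simp
  next
    case True
    have "\<not> insert v P \<subseteq> adjacent E k"
      using k(2) card_mono[of "adjacent E k" "insert v P"]
      by (auto simp: degree_eq_card_adjacent[OF st(1)])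
    then obtain i where i: "i \<in> P" "i \<notin> adjacent E k"
      using True adjacent_sym[of k E v] by blast
    have "degree E v < degree E i" using less le st(4)[OF i(1)] i(1) by (metis less_le_trans)
    then obtain u where u: "u \<in> adjacent E i" "u \<notin> adjacent E v" "u \<noteq> v"
      using exchange_neighbour[OF st(1)] by blast
    have uB: "u \<in> B" using nb[OF u(1)] i fin by blast
    have ne: "u \<noteq> k" "i \<noteq> k" "i \<noteq> v" "u \<noteq> i"
      using True u i kP fin uB by (auto simp: adjacent_sym)
    obtain E0 where E0: "E = add_mset {#u, i#} E0" "{#u, i#} \<notin># E0" "simple_graph (A \<union> B) E0"
      by (rule simple_graph_removeE[OF st(1) u(1)])
    define E' where "E' = add_mset {#v, u#} (add_mset {#i, k#} E0)"
    have "simple_graph (A \<union> B) E'"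
      unfolding E'_def simple_graph_add
      using E0 u i ne k uB kP fin by (auto simp: adjacent_def add_mset_commute pair_mset_eq_iff)
    moreover have "between (insert v P) B E'"
      using st(2) i(1) k(1) uB by (auto simp: E0(1) E'_def between_def)
    moreover have "degree E' w = degree E w + (if w = v \<or> w = k then 1 else 0)" for w
      using ne u kP by (auto simp: E0(1) E'_def)
    ultimately have "stage E'" "degree E v < degree E' v"
      unfolding stage_def bipartite_partial_realization_def
      using st(3,4) less k kP fin(5) by (auto simp: Suc_le_eq)
    then show ?thesis by blast
  qed
qed

text \<open>
  Necessity: each vertex of \<open>B\<close> receives at most \<open>min (card P) (d u)\<close> edges from
  \<open>P\<close>. Sufficiency: once all of \<open>A\<close> is finished, the equality of the sums finishes
  \<open>B\<close> too.
\<close>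

theorem gale_ryser:
  fixes d :: "'v \<Rightarrow> nat"
  assumes "finite A" "finite B" "A \<inter> B = {}"
  shows "(\<exists>E. simple_graph (A \<union> B) E \<and> between A B E \<and> (\<forall>v\<in>A \<union> B. degree E v = d v)) \<longleftrightarrow>
    sum d A = sum d B \<and> (\<forall>P. top_part d A P \<longrightarrow> sum d P \<le> (\<Sum>u\<in>B. min (card P) (d u)))"
    (is "?L \<longleftrightarrow> ?R")
proof
  assume ?L
  then obtain E where E: "simple_graph (A \<union> B) E" "between A B E" "\<And>v. v \<in> A \<union> B \<Longrightarrow> degree E v = d v"
    by blast
  have E': "between B A E" "B \<inter> A = {}" using E(2) assms(3) between_commute by blast+
  have "sum d A = (\<Sum>a\<in>A. degree E a)" "sum d B = (\<Sum>b\<in>B. degree E b)"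
    using E(3) by (auto intro: sum.cong)
  then have "sum d A = sum d B"
    using between_sum_degree[OF E(2) assms(3,1)] between_sum_degree[OF E'(1) E'(2) assms(2)]
    by simp
  moreover have "sum d P \<le> (\<Sum>u\<in>B. min (card P) (d u))" if "P \<subseteq> A" for P
  proof -
    have nb: "\<not> (u \<in> A \<and> x \<in> A)" "\<not> (u \<in> B \<and> x \<in> B)" if ux: "u \<in> adjacent E x" for u x
    proof -
      obtain a b where "a \<in> A" "b \<in> B" "{#u, x#} = {#a, b#}"
        using ux E(2) unfolding between_def adjacent_def by blast
      then show "\<not> (u \<in> A \<and> x \<in> A)" "\<not> (u \<in> B \<and> x \<in> B)"
        using assms(3) unfolding pair_mset_eq_iff by blast+
    qed
    have fP: "finite P" using that assms(1) by (rule finite_subset)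
    have "sum d P = (\<Sum>x\<in>P. degree E x)" using that E(3) by (intro sum.cong) auto
    also have "\<dots> = (\<Sum>x\<in>P. card (adjacent E x \<inter> P)) + (\<Sum>u\<in>A \<union> B - P. card (adjacent E u \<inter> P))"
      using that assms by (intro sum_degree_split E) auto
    also have "(\<Sum>x\<in>P. card (adjacent E x \<inter> P)) = 0"
      using nb(1) that by (intro sum.neutral) (auto simp: card_eq_0_iff)
    also have "(\<Sum>u\<in>A \<union> B - P. card (adjacent E u \<inter> P)) = (\<Sum>u\<in>B. card (adjacent E u \<inter> P))"
      using nb(1) that assms by (intro sum.mono_neutral_right) (auto simp: card_eq_0_iff)
    also have "\<dots> \<le> (\<Sum>u\<in>B. min (card P) (d u))"
    proof (rule sum_mono)
      fix u assume "u \<in> B"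
      then have "card (adjacent E u) = d u"
        using E(3) degree_eq_card_adjacent[OF E(1), of u] by simp
      then show "card (adjacent E u \<inter> P) \<le> min (card P) (d u)"
        using card_mono[of P "adjacent E u \<inter> P"] card_mono[of "adjacent E u" "adjacent E u \<inter> P"] fP
        by auto
    qed
    finally show ?thesis by simp
  qed
  ultimately show ?R by (auto simp: top_part_def)
next
  assume R: ?R
  define Q where "Q = (\<lambda>P. \<exists>E. bipartite_partial_realization A B d P P E)"
  have "\<exists>P. top_part d A P \<and> card P = card A \<and> Q P"
  proof (rule top_part_chain[OF assms(1) le_refl])
    show "Q {}" unfolding Q_def
      by (intro exI[of _ "{#}"]) (auto simp: bipartite_partial_realization_def between_def)
    fix P v
    assume top: "top_part d A (insert v P)" and v: "v \<in> A - P" "\<forall>p\<in>P. d v \<le> d p" and "Q P"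
    then obtain E where E: "bipartite_partial_realization A B d P P E" by (auto simp: Q_def)
    let ?stage = "bipartite_partial_realization A B d P (insert v P)"
    have "degree E v = 0"
      unfolding degree_eq_0_iff using E v assms
      by (fastforce simp: bipartite_partial_realization_def between_def)
    with E have "?stage E" by (auto simp: bipartite_partial_realization_def between_def)
    moreover have "\<forall>E. ?stage E \<longrightarrow> degree E v < Suc (d v)"
      by (auto simp: bipartite_partial_realization_def less_Suc_eq_le)
    \<comment> \<open>A graph with the largest possible degree at v admits no further step.\<close>
    ultimately obtain E where E: "?stage E" "\<And>E'. ?stage E' \<Longrightarrow> degree E' v \<le> degree E v"
      using ex_has_greatest_nat[of ?stage _ "\<lambda>E. degree E v"] by blast
    have PA: "insert v P \<subseteq> A" using top by (simp add: top_part_def)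
    have "\<not> degree E v < d v"
      using gale_ryser_step[of A B v P d E] E assms v PA R top by (meson DiffD2 not_le)
    then have "degree E v = d v" using E(1) by (auto simp: bipartite_partial_realization_def intro: antisym)
    with E(1) show "Q (insert v P)"
      unfolding Q_def by (intro exI[of _ E]) (auto simp: bipartite_partial_realization_def)
  qed
  then obtain P E where "P \<subseteq> A" "card P = card A" and E: "bipartite_partial_realization A B d P P E"
    by (auto simp: Q_def top_part_def)
  then have "P = A" using assms(1) card_subset_eq by blast
  with E have E: "simple_graph (A \<union> B) E" "between A B E"
    "\<And>u. u \<in> B \<Longrightarrow> degree E u \<le> d u" "\<And>p. p \<in> A \<Longrightarrow> degree E p = d p"
    by (auto simp: bipartite_partial_realization_def)
  have E': "between B A E" "B \<inter> A = {}" using E(2) assms(3) between_commute by blast+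
  have "(\<Sum>u\<in>B. degree E u) = size E" by (rule between_sum_degree[OF E' assms(2)])
  also have "\<dots> = sum d A"
    using between_sum_degree[OF E(2) assms(3,1)] E(4) by simp
  finally have "(\<Sum>u\<in>B. degree E u) = sum d B" using R by simp
  then have "degree E u = d u" if "u \<in> B" for u
    using sum_mono_inv[of "degree E" B d u] E(3) that assms(2) by blast
  with E show ?L by blast
qed

section \<open>Erdos-Gallai\<close>

text \<open>
  The vertices in \<open>P\<close> are finished, and those outside \<open>R\<close> are independent.
\<close>

definition partial_realization ::
    "'v set \<Rightarrow> ('v \<Rightarrow> nat) \<Rightarrow> 'v set \<Rightarrow> 'v set \<Rightarrow> 'v multiset multiset \<Rightarrow> bool"
  where "partial_realization V d P R E \<longleftrightarrow> simple_graph V E \<and> (\<forall>e\<in>#E. \<exists>x\<in>R. x \<in># e) \<and>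
    (\<forall>u\<in>V. degree E u \<le> d u) \<and> (\<forall>p\<in>P. degree E p = d p)"

text \<open>
  Suppose that no graph improves the degree of \<open>v\<close>. Each of the following configurations
  would allow a switch that does, so none occurs: a deficient vertex not adjacent to \<open>v\<close>; a
  finished vertex not adjacent to \<open>v\<close>; another unfinished vertex \<open>k\<close> of degree below
  \<open>min (card (insert v P)) (d k)\<close>; two non-adjacent finished vertices. Then
  \<open>insert v P\<close> is a clique, and all other vertices have as many neighbours in it as the
  right side of the inequality grants them. The degrees on \<open>insert v P\<close> therefore add up
  to exactly that right side, whereas the deficiency of \<open>v\<close> makes their sum smaller than
  the left side.
\<close>

lemma erdos_gallai_step:
  fixes V P :: "'v set" and d :: "'v \<Rightarrow> nat" and v :: 'v
  assumes fin: "finite V" "insert v P \<subseteq> V" "v \<notin> P"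
    and even: "even (sum d V)"
    and le: "\<forall>p\<in>P. d v \<le> d p"
    and EG: "sum d (insert v P) \<le> card (insert v P) * (card (insert v P) - 1)
      + (\<Sum>u\<in>V - insert v P. min (card (insert v P)) (d u))"
    and E: "partial_realization V d P (insert v P) E" and less: "degree E v < d v"
  shows "\<exists>E'. partial_realization V d P (insert v P) E' \<and> degree E v < degree E' v"
proof (rule ccontr)
  assume contr: "\<not> ?thesis"
  have finP: "finite (insert v P)" using fin(2,1) by (rule finite_subset)
  have st: "simple_graph V E" "\<And>e. e \<in># E \<Longrightarrow> \<exists>x\<in>insert v P. x \<in># e"
    "\<And>u. u \<in> V \<Longrightarrow> degree E u \<le> d u" "\<And>p. p \<in> P \<Longrightarrow> degree E p = d p"
    using E unfolding partial_realization_def by blast+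
  have contr': False
    if "simple_graph V E'" "\<And>e. e \<in># E' \<Longrightarrow> \<exists>x\<in>insert v P. x \<in># e"
      "\<And>u. u \<in> V \<Longrightarrow> degree E' u \<le> d u" "\<And>p. p \<in> P \<Longrightarrow> degree E' p = d p"
      "degree E v < degree E' v" for E'
    using contr that unfolding partial_realization_def by blast
  have nbP: "x \<in> insert v P \<or> u \<in> insert v P" if "u \<in> adjacent E x" for u x
    using st(2)[of "{#u, x#}"] that by (auto simp: adjacent_def)
  have PV: "P \<subseteq> V" "v \<in> V" using fin(2) by auto

  have deficient: "k \<in> adjacent E v" if k: "k \<in> V" "k \<noteq> v" "degree E k < d k" for k
  proof (rule ccontr)
    assume "k \<notin> adjacent E v"
    then have "simple_graph V (add_mset {#k, v#} E)"
      using k st(1) PV by (simp add: simple_graph_add adjacent_def)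
    then show False
    proof (rule contr')
      show "degree (add_mset {#k, v#} E) u \<le> d u" if "u \<in> V" for u
        using that k less st(3)[OF that] by auto
      show "degree (add_mset {#k, v#} E) p = d p" if "p \<in> P" for p
        using that k st(4)[OF that] fin(3) by auto
    qed (use k st(2) in auto)
  qed
  have other: "\<exists>u. u \<in> adjacent E i \<and> u \<notin> adjacent E v \<and> u \<noteq> v" if "i \<in> P" for i
  proof -
    have "degree E v < degree E i" using le less st(4) that by (metis less_le_trans)
    from exchange_neighbour[OF st(1) this] show ?thesis by blast
  qed

  have joined: "i \<in> adjacent E v" if i: "i \<in> P" for i
  proof (rule ccontr)
    assume ni: "i \<notin> adjacent E v"
    obtain u where u: "u \<in> adjacent E i" "u \<notin> adjacent E v" "u \<noteq> v" using other[OF i] by blast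
    obtain E0 where E0: "E = add_mset {#u, i#} E0" "u \<in> V" "i \<in> V" "u \<noteq> i"
        "{#u, i#} \<notin># E0" "simple_graph V E0"
      by (rule simple_graph_removeE[OF st(1) u(1)])
    have iv: "i \<noteq> v" using i fin(3) by blast
    show False
    \<comment> \<open>The obvious switch lets both u and i become neighbours of v, which raises the degree of v
        by 2. If only 1 is missing, an edge from v to another deficient vertex k is given up.\<close>
    proof (cases "degree E v + 2 \<le> d v")
      case True
      define E' where "E' = add_mset {#u, v#} (add_mset {#i, v#} E0)"
      have dE: "degree E' w = degree E w + (if w = v then 2 else 0)" for w
        using E0(4) u(3) iv by (auto simp: E'_def E0(1))
      have "simple_graph V E'"
        unfolding E'_def simple_graph_add using E0 u ni iv PV
        by (auto simp: adjacent_def pair_mset_eq_iff)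
      then show False
      proof (rule contr')
        show "\<exists>x\<in>insert v P. x \<in># e" if "e \<in># E'" for e
          using that st(2)[of e] by (auto simp: E'_def E0(1))
        show "degree E' w \<le> d w" if "w \<in> V" for w
          using st(3)[OF that] True by (auto simp: dE)
        show "degree E' p = d p" if "p \<in> P" for p
          using st(4)[OF that] that fin(3) by (auto simp: dE)
      qed (simp add: dE)
    next
      case False
      \<comment> \<open>Otherwise sum d V would be odd, being one more than the sum of the degrees of E.\<close>
      have "\<exists>k\<in>V - {v}. degree E k < d k"
      proof (rule ccontr)
        assume "\<not> ?thesis"
        then have "(\<Sum>k\<in>V - {v}. degree E k) = sum d (V - {v})"
          using st(3) by (intro sum.cong) (auto intro: antisym simp: not_less)
        then have "sum d V = (\<Sum>k\<in>V. degree E k) + 1"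
          using sum.remove[OF fin(1) PV(2), of d] sum.remove[OF fin(1) PV(2), of "degree E"]
            False less by linarith
        then have "sum d V = 2 * size E + 1"
          using handshake[OF fin(1) simple_graph_multigraph[OF st(1)]] by simp
        with even show False by simp
      qed
      then obtain k where k: "k \<in> V" "k \<noteq> v" "degree E k < d k" by blast
      have kv: "k \<in> adjacent E v" by (rule deficient[OF k])
      have ne: "k \<noteq> u" "k \<noteq> i" using kv u ni by auto
      have "k \<in> adjacent E0 v"
        using kv ne iv by (auto simp: E0(1) adjacent_def pair_mset_eq_iff)
      then obtain E1 where E1: "E0 = add_mset {#k, v#} E1" "simple_graph V E1"
        by (rule simple_graph_removeE[OF E0(6)])
      define E' where "E' = add_mset {#u, v#} (add_mset {#i, v#} E1)"
      have dE: "degree E w = degree E' w + (if w = k then 1 else 0) - (if w = v then 1 else 0)"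
        and dE': "degree E' v = degree E v + 1" for w
        using E0(4) u(3) iv ne k(2) by (auto simp: E'_def E0(1) E1(1))
      have "simple_graph V E'"
        unfolding E'_def simple_graph_add using E0 E1 u ni iv PV
        by (auto simp: adjacent_def pair_mset_eq_iff)
      then show False
      proof (rule contr')
        show "\<exists>x\<in>insert v P. x \<in># e" if "e \<in># E'" for e
          using that st(2)[of e] by (auto simp: E'_def E0(1) E1(1))
        show "degree E' w \<le> d w" if "w \<in> V" for w
          using st(3)[OF that] dE[of w] dE' less by (cases "w = v") auto
        show "degree E' p = d p" if "p \<in> P" for p
          using st(4)[OF that] dE[of p] that fin(3) k(3) st(4)[of k] by (cases "p = k"; cases "p = v") auto
      qed (simp add: dE')
    qed
  qed

  have outside: "degree E k = min (card (insert v P)) (d k)" if k: "k \<in> V - insert v P" for k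
  proof (rule ccontr)
    assume neq: "degree E k \<noteq> min (card (insert v P)) (d k)"
    have sub: "adjacent E k \<subseteq> insert v P" using nbP[of _ k] k by blast
    then have "degree E k \<le> card (insert v P)"
      unfolding degree_eq_card_adjacent[OF st(1)] by (rule card_mono[OF finP])
    with neq st(3)[of k] k have dk: "degree E k < card (insert v P)" "degree E k < d k"
      by auto
    have kv: "k \<in> adjacent E v" using deficient k dk(2) by blast
    have "\<not> insert v P \<subseteq> adjacent E k"
      using dk(1) card_mono[OF finite_adjacent, of "insert v P" E k]
      by (auto simp: degree_eq_card_adjacent[OF st(1)])
    then obtain i where i: "i \<in> P" "i \<notin> adjacent E k" using kv adjacent_sym[of k E v] by blast
    obtain u where u: "u \<in> adjacent E i" "u \<notin> adjacent E v" "u \<noteq> v" using other[OF i(1)] by blast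
    obtain E0 where E0: "E = add_mset {#u, i#} E0" "u \<in> V" "i \<in> V" "u \<noteq> i"
        "{#u, i#} \<notin># E0" "simple_graph V E0"
      by (rule simple_graph_removeE[OF st(1) u(1)])
    have ne: "i \<noteq> v" "k \<noteq> v" "i \<noteq> k" "u \<noteq> k" using i k kv u fin(3) by auto
    \<comment> \<open>i takes k as a neighbour and cedes u to v.\<close>
    define E' where "E' = add_mset {#u, v#} (add_mset {#i, k#} E0)"
    have dE: "degree E' w = degree E w + (if w = v \<or> w = k then 1 else 0)" for w
      using E0(4) u(3) ne by (auto simp: E'_def E0(1))
    have "simple_graph V E'"
      unfolding E'_def simple_graph_add using E0 u i ne k PV
      by (auto simp: adjacent_def pair_mset_eq_iff)
    then show False
    proof (rule contr')
      show "\<exists>x\<in>insert v P. x \<in># e" if "e \<in># E'" for e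
        using that st(2)[of e] i by (auto simp: E'_def E0(1))
      show "degree E' w \<le> d w" if "w \<in> V" for w
        using st(3)[OF that] less dk(2) by (auto simp: dE)
      show "degree E' p = d p" if "p \<in> P" for p
        using st(4)[OF that] that fin(3) k by (auto simp: dE)
    qed (simp add: dE)
  qed

  have clique: "j \<in> adjacent E i" if ij: "i \<in> P" "j \<in> P" "i \<noteq> j" for i j
  proof (rule ccontr)
    assume nij: "j \<notin> adjacent E i"
    obtain u where u: "u \<in> adjacent E i" "u \<notin> adjacent E v" "u \<noteq> v" using other[OF ij(1)] by blast
    obtain w where w: "w \<in> adjacent E j" "w \<notin> adjacent E v" "w \<noteq> v" using other[OF ij(2)] by blast
    have uw: "u \<notin> P" "w \<notin> P" using joined u w by auto
    obtain E0 where E0: "E = add_mset {#u, i#} E0" "u \<in> V" "i \<in> V" "u \<noteq> i"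
        "{#u, i#} \<notin># E0" "simple_graph V E0"
      by (rule simple_graph_removeE[OF st(1) u(1)])
    have "w \<in> adjacent E0 j"
      using w(1) uw ij by (auto simp: E0(1) adjacent_def pair_mset_eq_iff)
    then obtain E1 where E1: "E0 = add_mset {#w, j#} E1" "j \<in> V" "w \<noteq> j" "simple_graph V E1"
      by (rule simple_graph_removeE[OF E0(6)])
    have ne: "i \<noteq> v" "j \<noteq> v" using ij fin(3) by auto
    \<comment> \<open>i and j give up u and w for each other, and v takes u. The vertex w loses degree, but it is
        not finished; possibly w = u.\<close>
    define E' where "E' = add_mset {#u, v#} (add_mset {#j, i#} E1)"
    have dE: "degree E x = degree E' x + (if x = w then 1 else 0) - (if x = v then 1 else 0)"
      and dE': "degree E' v = degree E v + 1" for x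
      using E0(4) u(3) w(3) ne ij E1(3) by (auto simp: E'_def E0(1) E1(1))
    have "simple_graph V E'"
      unfolding E'_def simple_graph_add using E0 E1 u nij ne ij PV uw
      by (auto simp: adjacent_def pair_mset_eq_iff)
    then show False
    proof (rule contr')
      show "\<exists>x\<in>insert v P. x \<in># e" if "e \<in># E'" for e
        using that st(2)[of e] ij by (auto simp: E'_def E0(1) E1(1))
      show "degree E' x \<le> d x" if "x \<in> V" for x
        using st(3)[OF that] dE[of x] dE' less by (cases "x = v") auto
      show "degree E' p = d p" if "p \<in> P" for p
        using st(4)[OF that] dE[of p] that fin(3) uw by (cases "p = w"; cases "p = v") auto
    qed (simp add: dE')
  qed

  have "adjacent E x \<inter> insert v P = insert v P - {x}" if "x \<in> insert v P" for x
    using that joined clique simple_graphD(3)[OF st(1), of x x] adjacent_sym[of v E] by blast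
  then have "(\<Sum>x\<in>insert v P. card (adjacent E x \<inter> insert v P)) =
      (\<Sum>x\<in>insert v P. card (insert v P) - 1)"
    using finP by (intro sum.cong refl) (simp only: card_Diff_singleton)
  moreover have "(\<Sum>u\<in>V - insert v P. card (adjacent E u \<inter> insert v P)) =
      (\<Sum>u\<in>V - insert v P. min (card (insert v P)) (d u))"
  proof (rule sum.cong[OF refl])
    fix u assume u: "u \<in> V - insert v P"
    then have "adjacent E u \<inter> insert v P = adjacent E u" using nbP[of _ u] by blast
    then show "card (adjacent E u \<inter> insert v P) = min (card (insert v P)) (d u)"
      using outside[OF u] degree_eq_card_adjacent[OF st(1), of u] by simp
  qed
  ultimately have "(\<Sum>x\<in>insert v P. degree E x) = card (insert v P) * (card (insert v P) - 1)
      + (\<Sum>u\<in>V - insert v P. min (card (insert v P)) (d u))"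
    unfolding sum_degree_split[OF fin(1) st(1) fin(2)] by simp
  moreover have "(\<Sum>x\<in>insert v P. degree E x) < sum d (insert v P)"
    using finP st(3) less fin(2) by (intro sum_strict_mono_ex1) auto
  ultimately show False using EG by simp
qed

text \<open>
  Necessity: a vertex of \<open>P\<close> has at most \<open>card P - 1\<close> neighbours in
  \<open>P\<close>, and a vertex \<open>u\<close> outside has at most \<open>min (card P) (d u)\<close>.
\<close>

theorem erdos_gallai:
  fixes d :: "'v \<Rightarrow> nat"
  assumes "finite V"
  shows "(\<exists>E. simple_graph V E \<and> (\<forall>v\<in>V. degree E v = d v)) \<longleftrightarrow>
    even (sum d V) \<and> (\<forall>P. top_part d V P \<longrightarrow>
      sum d P \<le> card P * (card P - 1) + (\<Sum>u\<in>V - P. min (card P) (d u)))"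
    (is "?L \<longleftrightarrow> ?R")
proof
  assume ?L
  then obtain E where E: "simple_graph V E" "\<And>v. v \<in> V \<Longrightarrow> degree E v = d v" by blast
  have "sum d V = (\<Sum>v\<in>V. degree E v)" using E(2) by simp
  then have "even (sum d V)"
    using handshake[OF assms simple_graph_multigraph[OF E(1)]] by simp
  moreover have "sum d P \<le> card P * (card P - 1) + (\<Sum>u\<in>V - P. min (card P) (d u))"
    if P: "P \<subseteq> V" for P
  proof -
    have fP: "finite P" using P assms by (rule finite_subset)
    have "sum d P = (\<Sum>x\<in>P. degree E x)" using P E(2) by (intro sum.cong) auto
    also have "\<dots> = (\<Sum>x\<in>P. card (adjacent E x \<inter> P)) + (\<Sum>u\<in>V - P. card (adjacent E u \<inter> P))"
      by (rule sum_degree_split[OF assms E(1) P])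
    also have "(\<Sum>x\<in>P. card (adjacent E x \<inter> P)) \<le> (\<Sum>x\<in>P. card P - 1)"
    proof (rule sum_mono)
      fix x assume "x \<in> P"
      have "adjacent E x \<inter> P \<subseteq> P - {x}" using simple_graphD(3)[OF E(1)] by blast
      then have "card (adjacent E x \<inter> P) \<le> card (P - {x})" using fP by (intro card_mono) auto
      then show "card (adjacent E x \<inter> P) \<le> card P - 1"
        using \<open>x \<in> P\<close> by (simp add: card_Diff_singleton)
    qed
    also have "(\<Sum>x\<in>P. card P - 1) = card P * (card P - 1)" by simp
    also have "(\<Sum>u\<in>V - P. card (adjacent E u \<inter> P)) \<le> (\<Sum>u\<in>V - P. min (card P) (d u))"
    proof (rule sum_mono)
      fix u assume "u \<in> V - P"
      then have "card (adjacent E u) = d u"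
        using E(2) degree_eq_card_adjacent[OF E(1), of u] by simp
      then show "card (adjacent E u \<inter> P) \<le> min (card P) (d u)"
        using card_mono[OF fP, of "adjacent E u \<inter> P"]
          card_mono[OF finite_adjacent, of "adjacent E u \<inter> P" E u] by simp
    qed
    finally show ?thesis by simp
  qed
  ultimately show ?R by (auto simp: top_part_def)
next
  assume R: ?R
  define Q where "Q = (\<lambda>P. \<exists>E. partial_realization V d P P E)"
  have "\<exists>P. top_part d V P \<and> card P = card V \<and> Q P"
  proof (rule top_part_chain[OF assms le_refl])
    show "Q {}" unfolding Q_def
      by (intro exI[of _ "{#}"]) (auto simp: partial_realization_def)
    fix P v
    assume top: "top_part d V (insert v P)" and v: "v \<in> V - P" "\<forall>p\<in>P. d v \<le> d p" and "Q P"
    then obtain E where "partial_realization V d P P E" by (auto simp: Q_def)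
    then have "partial_realization V d P (insert v P) E" unfolding partial_realization_def by blast
    moreover have "\<forall>E. partial_realization V d P (insert v P) E \<longrightarrow> degree E v < Suc (d v)"
      using v(1) unfolding partial_realization_def by (simp add: less_Suc_eq_le)
    ultimately obtain E where E: "partial_realization V d P (insert v P) E"
        "\<And>E'. partial_realization V d P (insert v P) E' \<Longrightarrow> degree E' v \<le> degree E v"
      using ex_has_greatest_nat[of "partial_realization V d P (insert v P)" _ "\<lambda>E. degree E v"] by blast
    have PV: "insert v P \<subseteq> V" "v \<notin> P" using top v(1) by (simp_all add: top_part_def)
    have "\<not> degree E v < d v"
      using erdos_gallai_step[OF assms PV _ v(2) _ E(1)] E(2) R top by (meson not_le)
    moreover have "degree E v \<le> d v" using E(1) v(1) unfolding partial_realization_def by blast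
    ultimately have "degree E v = d v" by simp
    with E(1) show "Q (insert v P)"
      unfolding Q_def by (intro exI[of _ E]) (simp add: partial_realization_def)
  qed
  then obtain P E where "P \<subseteq> V" "card P = card V" and E: "partial_realization V d P P E"
    by (auto simp: Q_def top_part_def)
  then have "P = V" using assms card_subset_eq by blast
  with E show ?L unfolding partial_realization_def by blast
qed

section \<open>Sorted sequences\<close>

lemma top_part_sort:
  assumes "finite A" "mset xs = image_mset f (mset_set A)" "top_part f A P"
  shows "mset (take (card P) (rev (sort xs))) = image_mset f (mset_set P)"
    and "mset (drop (card P) (rev (sort xs))) = image_mset f (mset_set (A - P))"
proof -
  have P: "P \<subseteq> A" "finite P" using assms(1,3) finite_subset by (auto simp: top_part_def)
  define hi where "hi = sorted_list_of_multiset (image_mset f (mset_set P))"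
  define lo where "lo = sorted_list_of_multiset (image_mset f (mset_set (A - P)))"
  have "sort xs = lo @ hi"
  proof (rule properties_for_sort)
    have "mset_set A = mset_set (A - P) + mset_set P"
      using P assms(1) mset_set_Union[of "A - P" P] by (simp add: Un_absorb2 Diff_disjoint Int_commute)
    then show "mset (lo @ hi) = mset xs" by (simp add: hi_def lo_def assms(2))
    show "sorted (lo @ hi)"
      using assms(1,3) P by (auto simp: sorted_append hi_def lo_def top_part_def)
  qed
  moreover have "length hi = card P"
    by (metis hi_def mset_sorted_list_of_multiset size_image_mset size_mset size_mset_set)
  ultimately show "mset (take (card P) (rev (sort xs))) = image_mset f (mset_set P)"
    and "mset (drop (card P) (rev (sort xs))) = image_mset f (mset_set (A - P))"
    by (simp_all add: hi_def lo_def)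
qed

lemma sum_index_eq_sum_list:
  "k \<le> length zs \<Longrightarrow> (\<Sum>g = 1..k. \<phi> (zs ! (g - 1))) = sum_list (map \<phi> (take k zs))"
  "(\<Sum>g = k + 1..length zs. \<phi> (zs ! (g - 1))) = sum_list (map \<phi> (drop k zs))"
  for \<phi> :: "'a \<Rightarrow> nat"
proof -
  have *: "(\<Sum>g = 1..k. \<phi> (zs ! (g - 1))) = sum_list (map \<phi> (take k zs))"
    if "k \<le> length zs" for k and zs :: "'a list"
  proof -
    have "(\<Sum>g = 1..k. \<phi> (zs ! (g - 1))) = (\<Sum>g<k. \<phi> (zs ! g))"
      by (rule sum.reindex_bij_witness[of _ Suc "\<lambda>g. g - 1"]) auto
    also have "\<dots> = sum_list (map \<phi> (take k zs))"
      using that by (simp add: sum_list_sum_nth atLeast0LessThan)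
    finally show ?thesis .
  qed
  then show "k \<le> length zs \<Longrightarrow> (\<Sum>g = 1..k. \<phi> (zs ! (g - 1))) = sum_list (map \<phi> (take k zs))" .
  have "(\<Sum>g = k + 1..length zs. \<phi> (zs ! (g - 1))) =
      (\<Sum>g = 1..length (drop k zs). \<phi> (drop k zs ! (g - 1)))"
    by (rule sum.reindex_bij_witness[of _ "\<lambda>g. g + k" "\<lambda>g. g - k"]) (auto simp: add.commute)
  also have "\<dots> = sum_list (map \<phi> (take (length (drop k zs)) (drop k zs)))"
    by (rule *) simp
  finally show "(\<Sum>g = k + 1..length zs. \<phi> (zs ! (g - 1))) = sum_list (map \<phi> (drop k zs))"
    by simp
qed

lemma sum_list_image_mset:
  fixes \<phi> :: "'b \<Rightarrow> nat"
  assumes "mset zs = image_mset f (mset_set A)"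
  shows "sum_list (map \<phi> zs) = (\<Sum>x\<in>A. \<phi> (f x))"
proof -
  have "sum_list (map \<phi> zs) = sum_mset (image_mset \<phi> (mset zs))"
    by (simp add: sum_mset_sum_list[symmetric])
  then show ?thesis by (simp add: assms sum_unfold_sum_mset image_mset.compositionality comp_def)
qed

text \<open>
  A set with more than \<open>r\<close> elements satisfies its inequality anyway, since its sum is at most
  \<open>card P * r\<close>.
\<close>

lemma first_erdos_gallai_iff:
  assumes "finite A" "mset xs = image_mset f (mset_set A)" "\<And>x. x \<in> A \<Longrightarrow> f x \<le> r"
  shows "first_erdos_gallai r xs \<longleftrightarrow> (\<forall>P. top_part f A P \<longrightarrow>
    sum f P \<le> card P * (card P - 1) + (\<Sum>u\<in>A - P. min (card P) (f u)))"
proof -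
  have len: "length xs = card A"
    by (metis assms(2) size_image_mset size_mset size_mset_set)
  have ineq: "erdos_gallai_ineq xs (card P) \<longleftrightarrow>
      sum f P \<le> card P * (card P - 1) + (\<Sum>u\<in>A - P. min (card P) (f u))"
    and card: "card P \<le> card A" if P: "top_part f A P" for P
  proof -
    show card: "card P \<le> card A"
      using P assms(1) by (auto simp: top_part_def intro: card_mono)
    let ?d = "rev (sort xs)"
    have "(\<Sum>g = 1..card P. ?d ! (g - 1)) = sum f P"
      using sum_index_eq_sum_list(1)[of "card P" ?d "\<lambda>x. x"]
        sum_list_image_mset[OF top_part_sort(1)[OF assms(1,2) P], of "\<lambda>x. x"] card len by simp
    moreover have "(\<Sum>h = card P + 1..length ?d. min (card P) (?d ! (h - 1)))
        = (\<Sum>u\<in>A - P. min (card P) (f u))"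
      using sum_index_eq_sum_list(2)[of "min (card P)" ?d "card P"]
        sum_list_image_mset[OF top_part_sort(2)[OF assms(1,2) P], of "min (card P)"] by simp
    ultimately show "erdos_gallai_ineq xs (card P) \<longleftrightarrow>
        sum f P \<le> card P * (card P - 1) + (\<Sum>u\<in>A - P. min (card P) (f u))"
      by (simp only: erdos_gallai_ineq_def Let_def)
  qed
  show ?thesis
  proof (intro iffI allI impI)
    fix P assume *: "first_erdos_gallai r xs" and P: "top_part f A P"
    have "P \<subseteq> A" using P by (simp add: top_part_def)
    consider "card P = 0" | "1 \<le> card P" "card P \<le> r" | "r + 1 \<le> card P" by linarith
    then show "sum f P \<le> card P * (card P - 1) + (\<Sum>u\<in>A - P. min (card P) (f u))"
    proof cases
      case 1
      then show ?thesis using finite_subset[OF \<open>P \<subseteq> A\<close> assms(1)] by simp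
    next
      case 2
      with * ineq[OF P] card[OF P] len show ?thesis by (simp add: first_erdos_gallai_def)
    next
      case 3
      have "sum f P \<le> card P * r"
        using sum_bounded_above[of P f r] assms(3) \<open>P \<subseteq> A\<close> by auto
      also have "\<dots> \<le> card P * (card P - 1)" using 3 by (intro mult_le_mono2) simp
      finally show ?thesis by simp
    qed
  next
    assume *: "\<forall>P. top_part f A P \<longrightarrow>
      sum f P \<le> card P * (card P - 1) + (\<Sum>u\<in>A - P. min (card P) (f u))"
    show "first_erdos_gallai r xs"
      unfolding first_erdos_gallai_def
    proof (intro allI impI)
      fix k assume "1 \<le> k \<and> k \<le> length xs \<and> k \<le> r"
      then obtain P where "top_part f A P" "card P = k"
        using top_part_exists[OF assms(1), of k f] len by auto
      with * ineq show "erdos_gallai_ineq xs k" by metis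
    qed
  qed
qed

text \<open>
  If \<open>card P > r\<close>, the minimum on the right side is \<open>f u\<close>, and the inequality
  follows from the equality of the two sums.
\<close>

lemma first_gale_ryser_iff:
  assumes "finite A" "finite B" "mset xs = image_mset f (mset_set A)"
    and "mset ys = image_mset f (mset_set B)"
    and sum: "sum f A = sum f B" and bound: "\<And>u. u \<in> B \<Longrightarrow> f u \<le> Suc r"
  shows "first_gale_ryser r (xs, ys) \<longleftrightarrow> (\<forall>P. top_part f A P \<longrightarrow>
    sum f P \<le> (\<Sum>u\<in>B. min (card P) (f u)))"
proof -
  have len: "length xs = card A"
    by (metis assms(3) size_image_mset size_mset size_mset_set)
  have ineq: "gale_ryser_ineq (xs, ys) (card P) \<longleftrightarrow> sum f P \<le> (\<Sum>u\<in>B. min (card P) (f u))"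
    and card: "card P \<le> card A" if P: "top_part f A P" for P
  proof -
    show card: "card P \<le> card A"
      using P assms(1) by (auto simp: top_part_def intro: card_mono)
    let ?d = "rev (sort xs)"
    have "(\<Sum>g = 1..card P. ?d ! (g - 1)) = sum f P"
      using sum_index_eq_sum_list(1)[of "card P" ?d "\<lambda>x. x"]
        sum_list_image_mset[OF top_part_sort(1)[OF assms(1,3) P], of "\<lambda>x. x"] card len by simp
    moreover have "(\<Sum>h = 1..length ys. min (card P) (ys ! (h - 1))) = (\<Sum>u\<in>B. min (card P) (f u))"
      using sum_index_eq_sum_list(1)[of "length ys" ys "min (card P)"]
        sum_list_image_mset[OF assms(4), of "min (card P)"] by simp
    ultimately show "gale_ryser_ineq (xs, ys) (card P) \<longleftrightarrow>
        sum f P \<le> (\<Sum>u\<in>B. min (card P) (f u))"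
      by (simp only: gale_ryser_ineq_def Let_def fst_conv snd_conv)
  qed
  show ?thesis
  proof (intro iffI allI impI)
    fix P assume *: "first_gale_ryser r (xs, ys)" and P: "top_part f A P"
    have "P \<subseteq> A" using P by (simp add: top_part_def)
    consider "card P = 0" | "1 \<le> card P" "card P \<le> r" | "r + 1 \<le> card P" by linarith
    then show "sum f P \<le> (\<Sum>u\<in>B. min (card P) (f u))"
    proof cases
      case 1
      then show ?thesis using finite_subset[OF \<open>P \<subseteq> A\<close> assms(1)] by simp
    next
      case 2
      with * ineq[OF P] card[OF P] len show ?thesis by (simp add: first_gale_ryser_def)
    next
      case 3
      have "sum f P \<le> sum f A" by (rule sum_mono2[OF assms(1) \<open>P \<subseteq> A\<close>]) simp
      also have "\<dots> = (\<Sum>u\<in>B. min (card P) (f u))"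
        unfolding sum by (intro sum.cong refl) (use bound 3 in fastforce)
      finally show ?thesis .
    qed
  next
    assume *: "\<forall>P. top_part f A P \<longrightarrow> sum f P \<le> (\<Sum>u\<in>B. min (card P) (f u))"
    show "first_gale_ryser r (xs, ys)"
      unfolding first_gale_ryser_def
    proof (intro allI impI)
      fix k assume "1 \<le> k \<and> k \<le> length (fst (xs, ys)) \<and> k \<le> r"
      then obtain P where "top_part f A P" "card P = k"
        using top_part_exists[OF assms(1), of k f] len by auto
      with * ineq show "gale_ryser_ineq (xs, ys) k" by metis
    qed
  qed
qed

section \<open>One colour at a time\<close>

definition level :: "('v \<Rightarrow> stub_star) \<Rightarrow> 'v set \<Rightarrow> nat \<Rightarrow> 'v set"
  where "level S V i = {v \<in> V. size (S v) = i}"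

text \<open>
  Nothing has to be said about the ends of the edges: vertices whose stub-star has another size have
  degree 0 and thus lie on no edge.
\<close>

lemma colour_graph_same:
  assumes "multigraph V F"
  shows "colour_graph S V i i F \<longleftrightarrow> (\<forall>v\<in>V. degree F v = chromatic_degree i i (S v))"
proof
  assume *: "\<forall>v\<in>V. degree F v = chromatic_degree i i (S v)"
  have "image_mset (\<lambda>v. size (S v)) e = {#i, i#}" if e: "e \<in># F" for e
  proof -
    obtain a b where ab: "a \<in> V" "b \<in> V" "e = {#a, b#}"
      by (rule edge_pair[OF assms e])
    have "size (S x) = i" if "x \<in> V" "x \<in># e" for x
    proof (rule ccontr)
      assume "size (S x) \<noteq> i"
      then have "degree F x = 0" using * that(1) by (simp add: chromatic_degree_def)
      with e that(2) show False by (auto simp: degree_eq_0_iff)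
    qed
    with ab show ?thesis by simp
  qed
  with * show "colour_graph S V i i F" by (simp add: colour_graph_def)
qed (simp add: colour_graph_def)

lemma colour_graph_distinct:
  assumes "i \<noteq> j"
  shows "multigraph V F \<and> colour_graph S V i j F \<longleftrightarrow> between (level S V i) (level S V j) F \<and>
    (\<forall>v\<in>level S V i \<union> level S V j. degree F v = chromatic_degree i j (S v))"
    (is "?L \<longleftrightarrow> ?R")
proof
  assume L: ?L
  have "\<exists>a\<in>level S V i. \<exists>b\<in>level S V j. e = {#a, b#}" if e: "e \<in># F" for e
  proof -
    obtain a b where ab: "a \<in> V" "b \<in> V" "e = {#a, b#}"
      using edge_pair[OF conjunct1[OF L] e] by blast
    have "{#size (S a), size (S b)#} = {#i, j#}"
      using L e ab(3) by (auto simp: colour_graph_def)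
    then consider "size (S a) = i" "size (S b) = j" | "size (S a) = j" "size (S b) = i"
      unfolding pair_mset_eq_iff by blast
    then show ?thesis
    proof cases
      case 1
      with ab have "a \<in> level S V i" "b \<in> level S V j" by (simp_all add: level_def)
      with ab(3) show ?thesis by blast
    next
      case 2
      with ab have "b \<in> level S V i" "a \<in> level S V j" by (simp_all add: level_def)
      moreover have "e = {#b, a#}" using ab(3) by (simp add: add_mset_commute)
      ultimately show ?thesis by blast
    qed
  qed
  with L show ?R by (auto simp: between_def colour_graph_def level_def)
next
  assume R: ?R
  have "multigraph V F"
    using R unfolding between_def multigraph_def level_def by fastforce
  moreover have "image_mset (\<lambda>v. size (S v)) e = {#i, j#}" if "e \<in># F" for e
  proof -
    obtain a b where "a \<in> level S V i" "b \<in> level S V j" "e = {#a, b#}"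
      using R \<open>e \<in># F\<close> unfolding between_def by blast
    then show ?thesis by (simp add: level_def)
  qed
  moreover have "degree F v = chromatic_degree i j (S v)" if v: "v \<in> V" for v
  proof (cases "v \<in> level S V i \<union> level S V j")
    case False
    then have "v \<notin># e" if "e \<in># F" for e
      using R that unfolding between_def by fastforce
    then have "degree F v = 0" by (simp add: degree_eq_0_iff)
    with False v show ?thesis by (simp add: level_def chromatic_degree_def)
  qed (use R in blast)
  ultimately show ?L by (simp add: colour_graph_def)
qed

definition labels_at :: "('v \<Rightarrow> stub_star) \<Rightarrow> 'v set \<Rightarrow> nat \<Rightarrow> nat \<Rightarrow> nat"
  where "labels_at S V i j = (\<Sum>v\<in>level S V i. count (S v) j)"

lemma level_finite: "finite V \<Longrightarrow> finite (level S V i)"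
  and level_disjoint: "i \<noteq> j \<Longrightarrow> level S V i \<inter> level S V j = {}"
  and level_subset: "level S V i \<union> level S V j \<subseteq> V"
  by (auto simp: level_def)

lemma sum_chromatic_degree:
  shows "finite V \<Longrightarrow> (\<Sum>v\<in>V. chromatic_degree i i (S v)) = labels_at S V i i"
    and "i \<noteq> j \<Longrightarrow> (\<Sum>v\<in>level S V i. chromatic_degree i j (S v)) = labels_at S V i j"
    and "i \<noteq> j \<Longrightarrow> (\<Sum>v\<in>level S V j. chromatic_degree i j (S v)) = labels_at S V j i"
proof -
  show "finite V \<Longrightarrow> (\<Sum>v\<in>V. chromatic_degree i i (S v)) = labels_at S V i i"
    unfolding labels_at_def level_def
    by (simp add: sum.inter_filter) (auto intro: sum.cong simp: chromatic_degree_def)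
qed (auto simp: labels_at_def level_def chromatic_degree_def intro!: sum.cong)

lemma bipartite_colour_multigraph:
  assumes "finite V" "i \<noteq> j"
  shows "(\<exists>F. between (level S V i) (level S V j) F \<and>
      (\<forall>v\<in>level S V i \<union> level S V j. degree F v = chromatic_degree i j (S v)))
    \<longleftrightarrow> labels_at S V i j = labels_at S V j i" (is "?L \<longleftrightarrow> ?R")
proof
  let ?d = "\<lambda>v. chromatic_degree i j (S v)" and ?A = "level S V i" and ?B = "level S V j"
  note AB = level_finite[OF assms(1)] level_finite[OF assms(1)] level_disjoint[OF assms(2)]
  assume ?L
  then obtain F where F: "between ?A ?B F" "\<And>v. v \<in> ?A \<union> ?B \<Longrightarrow> degree F v = ?d v" by blast
  have F': "between ?B ?A F" "?B \<inter> ?A = {}"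
    using between_commute[THEN iffD1, OF F(1)] AB(3) by (simp_all add: Int_commute)
  have "sum ?d ?A = (\<Sum>v\<in>?A. degree F v)" "sum ?d ?B = (\<Sum>v\<in>?B. degree F v)"
    using F(2) by (auto intro: sum.cong)
  then show ?R
    using between_sum_degree[OF F(1) AB(3,1)] between_sum_degree[OF F' AB(2)]
    by (simp add: sum_chromatic_degree(2,3)[OF assms(2)])
next
  note AB = level_finite[OF assms(1)] level_finite[OF assms(1)] level_disjoint[OF assms(2)]
  assume ?R
  then show ?L
    by (intro bipartite_multigraph_with_degrees AB) (simp add: sum_chromatic_degree(2,3)[OF assms(2)])
qed

lemma multigraph_colour:
  assumes "finite V"
  shows "(\<exists>F. multigraph V F \<and> colour_graph S V i j F) \<longleftrightarrow>
    (if i = j then even (labels_at S V i i) else labels_at S V i j = labels_at S V j i)"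
proof (cases "i = j")
  case True
  let ?d = "\<lambda>v. chromatic_degree i i (S v)"
  have "(\<exists>F. multigraph V F \<and> colour_graph S V i i F) \<longleftrightarrow>
      (\<exists>F. multigraph V F \<and> (\<forall>v\<in>V. degree F v = ?d v))"
    using colour_graph_same by blast
  also have "\<dots> \<longleftrightarrow> even (sum ?d V)"
  proof
    assume "\<exists>F. multigraph V F \<and> (\<forall>v\<in>V. degree F v = ?d v)"
    then obtain F where F: "multigraph V F" "\<forall>v\<in>V. degree F v = ?d v" by blast
    then have "sum ?d V = (\<Sum>v\<in>V. degree F v)" by simp
    with handshake[OF assms F(1)] show "even (sum ?d V)" by simp
  qed (rule multigraph_with_degrees[OF assms])
  finally show ?thesis using True by (simp add: sum_chromatic_degree(1)[OF assms])
next
  case False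
  then show ?thesis
    by (simp add: colour_graph_distinct bipartite_colour_multigraph[OF assms])
qed

lemma loopless_multigraph_colour:
  assumes "finite V"
  shows "(\<exists>F. loopless_multigraph V F \<and> colour_graph S V i j F) \<longleftrightarrow>
    (if i = j then even (labels_at S V i i) \<and>
        (\<forall>v\<in>V. 2 * chromatic_degree i i (S v) \<le> labels_at S V i i)
     else labels_at S V i j = labels_at S V j i)"
proof (cases "i = j")
  case True
  let ?d = "\<lambda>v. chromatic_degree i i (S v)"
  have "(\<exists>F. loopless_multigraph V F \<and> colour_graph S V i i F) \<longleftrightarrow>
      (\<exists>F. loopless_multigraph V F \<and> (\<forall>v\<in>V. degree F v = ?d v))"
    using colour_graph_same unfolding loopless_multigraph_def by blast
  also have "\<dots> \<longleftrightarrow> even (sum ?d V) \<and> (\<forall>v\<in>V. 2 * ?d v \<le> sum ?d V)"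
  proof
    assume "\<exists>F. loopless_multigraph V F \<and> (\<forall>v\<in>V. degree F v = ?d v)"
    then obtain F where F: "loopless_multigraph V F" "\<forall>v\<in>V. degree F v = ?d v" by blast
    then have "sum ?d V = (\<Sum>v\<in>V. degree F v)" by simp
    also have "\<dots> = 2 * size F"
      using handshake[OF assms] F(1) unfolding loopless_multigraph_def by blast
    finally show "even (sum ?d V) \<and> (\<forall>v\<in>V. 2 * ?d v \<le> sum ?d V)"
      using loopless_degree_le_size[OF F(1)] F(2) by (metis dvd_triv_left mult_le_mono2)
  next
    assume "even (sum ?d V) \<and> (\<forall>v\<in>V. 2 * ?d v \<le> sum ?d V)"
    then show "\<exists>F. loopless_multigraph V F \<and> (\<forall>v\<in>V. degree F v = ?d v)"
      by (intro loopless_multigraph_with_degrees[OF assms]) blast+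
  qed
  finally show ?thesis using True by (simp add: sum_chromatic_degree(1)[OF assms])
next
  case False
  have "loopless_multigraph V F \<and> colour_graph S V i j F \<longleftrightarrow>
      multigraph V F \<and> colour_graph S V i j F" for F
    using colour_graph_distinct[OF False, of V F S] between_loopless[OF _ level_disjoint[OF False] level_subset]
    unfolding loopless_multigraph_def by blast
  with False show ?thesis
    by (simp add: colour_graph_distinct bipartite_colour_multigraph[OF assms])
qed

lemma simple_graph_colour:
  fixes S :: "'v \<Rightarrow> stub_star"
  defines "d \<equiv> \<lambda>i j v. chromatic_degree i j (S v)"
  assumes "finite V"
  shows "(\<exists>F. simple_graph V F \<and> colour_graph S V i j F) \<longleftrightarrow>
    (if i = j then even (labels_at S V i i) \<and>
        (\<forall>P. top_part (d i i) V P \<longrightarrow>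
          sum (d i i) P \<le> card P * (card P - 1) + (\<Sum>u\<in>V - P. min (card P) (d i i u)))
     else labels_at S V i j = labels_at S V j i \<and>
        (\<forall>P. top_part (d i j) (level S V i) P \<longrightarrow>
          sum (d i j) P \<le> (\<Sum>u\<in>level S V j. min (card P) (d i j u))))"
proof (cases "i = j")
  case True
  have "(\<exists>F. simple_graph V F \<and> colour_graph S V i i F) \<longleftrightarrow>
      (\<exists>F. simple_graph V F \<and> (\<forall>v\<in>V. degree F v = d i i v))"
    using colour_graph_same simple_graph_multigraph unfolding d_def by blast
  moreover have "sum (d i i) V = labels_at S V i i"
    unfolding d_def by (rule sum_chromatic_degree(1)[OF assms(2)])
  ultimately show ?thesis using True by (simp add: erdos_gallai[OF assms(2)])
next
  case False
  let ?A = "level S V i" and ?B = "level S V j"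
  have "simple_graph V F \<and> colour_graph S V i j F \<longleftrightarrow>
      simple_graph (?A \<union> ?B) F \<and> between ?A ?B F \<and> (\<forall>v\<in>?A \<union> ?B. degree F v = d i j v)" for F
  proof -
    have "simple_graph V F \<longleftrightarrow> multigraph V F \<and> simple_graph (?A \<union> ?B) F"
      if "between ?A ?B F"
      using between_loopless[OF that level_disjoint[OF False] level_subset]
        between_loopless[OF that level_disjoint[OF False] subset_refl]
      unfolding simple_graph_def loopless_multigraph_def by blast
    then show ?thesis
      using colour_graph_distinct[OF False, of V F S] simple_graph_multigraph[of V F]
      unfolding d_def by blast
  qed
  moreover have "sum (d i j) ?A = labels_at S V i j" "sum (d i j) ?B = labels_at S V j i"
    unfolding d_def by (rule sum_chromatic_degree(2,3)[OF False])+
  ultimately show ?thesis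
    using False gale_ryser[OF level_finite[OF assms(2)] level_finite[OF assms(2)] level_disjoint[OF False]]
    by simp
qed

section \<open>Ensembles\<close>

lemma mset_filter_nth:
  "mset (filter p xs) = image_mset ((!) xs) (mset_set {v \<in> {..<length xs}. p (xs ! v)})"
proof -
  have "mset xs = image_mset ((!) xs) (mset_set {..<length xs})"
    by (metis atLeast0LessThan map_nth mset_map mset_upt)
  then show ?thesis
    by (simp add: filter_mset_image_mset)
qed

lemma label_sum_eq_labels_at:
  "label_sum Ss i j = labels_at ((!) Ss) {..<length Ss} i j"
proof -
  let ?xs = "filter (\<lambda>l. size l = i) Ss"
  have cl: "count_list ?xs l = (if size l = i then count (mset Ss) l else 0)" for l
    by (induction Ss) auto
  have "label_sum Ss i j = (\<Sum>l\<in>set ?xs. count_list ?xs l * count l j)"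
    unfolding label_sum_def x_mult_def
    by (intro sum.cong) (auto simp: cl)
  also have "\<dots> = sum_list (map (\<lambda>l. count l j) ?xs)"
    by (rule sum_list_map_eq_sum_count[symmetric])
  also have "\<dots> = labels_at ((!) Ss) {..<length Ss} i j"
    unfolding labels_at_def level_def by (rule sum_list_image_mset[OF mset_filter_nth])
  finally show ?thesis .
qed

lemma balanced_iff_labels_at:
  "balanced Ss \<longleftrightarrow> (let L = labels_at ((!) Ss) {..<length Ss} in
     (\<forall>i>0. \<forall>j>0. if i = j then even (L i i) else L i j = L j i))"
  by (auto simp: balanced_def Let_def label_sum_eq_labels_at even_iff_mod_2_eq_zero)

text \<open>
  The factor \<open>min 1 (x_mult Ss l)\<close> discards the partitions that do not occur in the ensemble.
  The set is finite, since no label occurs more than \<open>i\<close> times in a partition of height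
  \<open>i\<close>, and it is not empty, so its maximum is meaningful.
\<close>

lemma Max_label_multiplicity_le_iff:
  assumes "ensemble Ss" "i > 0"
  shows "2 * Max {min 1 (x_mult Ss l) * count l i | l. is_partition l \<and> size l = i} \<le> b \<longleftrightarrow>
    (\<forall>v\<in>{..<length Ss}. 2 * chromatic_degree i i (Ss ! v) \<le> b)"
    (is "2 * Max ?M \<le> b \<longleftrightarrow> ?R")
proof -
  have "m \<le> i" if m: "m \<in> ?M" for m
  proof -
    obtain l where "m = min 1 (x_mult Ss l) * count l i" "size l = i" using m by blast
    then show ?thesis
      using count_le_size[of l i] by (cases "x_mult Ss l") auto
  qed
  then have fin: "finite ?M" by (meson finite_nat_set_iff_bounded_le)
  have "is_partition (replicate_mset i i)" using assms(2) by (simp add: is_partition_def)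
  then have ne: "?M \<noteq> {}" by (auto intro!: exI[of _ "replicate_mset i i"])
  have "2 * Max ?M \<le> b \<longleftrightarrow> (\<forall>m\<in>?M. 2 * m \<le> b)"
    using Max_in[OF fin ne] Max_ge[OF fin] by (meson le_trans mult_le_mono2)
  also have "\<dots> \<longleftrightarrow> (\<forall>l\<in>set Ss. size l = i \<longrightarrow> 2 * count l i \<le> b)"
  proof (intro iffI ballI impI)
    fix l assume *: "\<forall>m\<in>?M. 2 * m \<le> b" and l: "l \<in> set Ss" "size l = i"
    have "min 1 (x_mult Ss l) = 1" using l(1) by (simp add: x_mult_def Suc_le_eq min_def)
    then have "count l i \<in> ?M"
      using l assms(1) by (force simp: ensemble_def)
    with * show "2 * count l i \<le> b" by blast
  next
    fix m assume *: "\<forall>l\<in>set Ss. size l = i \<longrightarrow> 2 * count l i \<le> b" and "m \<in> ?M"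
    then obtain l where "m = min 1 (x_mult Ss l) * count l i" "size l = i" by blast
    with * show "2 * m \<le> b" by (cases "l \<in> set Ss") (auto simp: x_mult_def min_def count_mset_0_iff[THEN iffD2])
  qed
  also have "\<dots> \<longleftrightarrow> ?R"
    by (auto simp: chromatic_degree_def all_set_conv_all_nth)
  finally show ?thesis .
qed

lemma chromatic_degree_le_size: "chromatic_degree i j S \<le> size S"
  by (metis chromatic_degree_def count_le_size le0)

lemma size_le_max_degree: "v < length Ss \<Longrightarrow> size (Ss ! v) \<le> max_degree Ss"
  by (simp add: max_degree_def)

text \<open>
  The colour-wise criteria have this form, with \<open>P\<close> and \<open>R\<close> the balance conditions.
\<close>

lemma separate_conditions:
  "(\<forall>i>0. \<forall>j>0. if i = j then P i \<and> Q i else R i j \<and> T i j) \<longleftrightarrow>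
    (\<forall>i>0. \<forall>j>0. if i = j then P i else R i j) \<and> (\<forall>i>0. Q i) \<and>
    (\<forall>i>0. \<forall>j>0. i \<noteq> j \<longrightarrow> T i j)" for P Q :: "nat \<Rightarrow> bool"
  by auto

theorem theorem12:
  fixes Ss :: "stub_star list" and \<Delta> :: nat
  assumes "ensemble Ss"
    and "\<Delta> = max_degree Ss"
  shows "(multigraph_realizable Ss \<longleftrightarrow> balanced Ss) \<and>
         (loopless_multigraph_realizable Ss \<longleftrightarrow>
            balanced Ss \<and>
            (\<forall>i > 0. 2 * Max {min 1 (x_mult Ss l) * count l i | l. is_partition l \<and> size l = i}
                       \<le> label_sum Ss i i)) \<and>
         (simple_graph_realizable Ss \<longleftrightarrow>
            balanced Ss \<and>
            (\<forall>i > 0. first_erdos_gallai \<Delta> (D_same Ss i)) \<and>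
            (\<forall>i > 0. \<forall>j > 0. i \<noteq> j \<longrightarrow> first_gale_ryser (\<Delta> - 1) (D_bip Ss i j)))"
proof (intro conjI)
  define V where "V = {..<length Ss}"
  define S where "S = (!) Ss"
  define L where "L = labels_at S V"
  define d where "d = (\<lambda>i j v. chromatic_degree i j (S v))"
  have finV: "finite V" by (simp add: V_def)
  have part: "is_partition (S v)" if "v \<in> V" for v
    using assms(1) that by (simp add: ensemble_def V_def S_def)
  have realizes: "realizes E Ss \<longleftrightarrow> (\<forall>v\<in>V. image_mset (degree E) (neighbours E v) = S v)" for E
    by (auto simp: realizes_def V_def S_def)
  note split = realizable_iff_colour_graphs[OF finV part]
  have bal: "balanced Ss \<longleftrightarrow> (\<forall>i>0. \<forall>j>0. if i = j then even (L i i) else L i j = L j i)"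
    using balanced_iff_labels_at[of Ss] by (simp only: Let_def L_def V_def S_def)
  have lab: "label_sum Ss i j = L i j" for i j
    by (simp add: label_sum_eq_labels_at L_def V_def S_def)

  have "multigraph_realizable Ss \<longleftrightarrow> (\<forall>i>0. \<forall>j>0. \<exists>F. multigraph V F \<and> colour_graph S V i j F)"
    unfolding multigraph_realizable_def V_def[symmetric] realizes
    by (rule split) (simp_all add: graph_class_by_colours(1)[symmetric])
  then show "multigraph_realizable Ss \<longleftrightarrow> balanced Ss"
    by (simp only: multigraph_colour[OF finV] bal L_def)

  have "loopless_multigraph_realizable Ss \<longleftrightarrow>
      (\<forall>i>0. \<forall>j>0. \<exists>F. loopless_multigraph V F \<and> colour_graph S V i j F)"
    unfolding loopless_multigraph_realizable_def V_def[symmetric] realizes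
    by (rule split) (simp_all add: graph_class_by_colours(2)[symmetric],
      simp add: loopless_multigraph_def)
  also have "\<dots> \<longleftrightarrow> balanced Ss \<and> (\<forall>i>0. \<forall>v\<in>V. 2 * chromatic_degree i i (S v) \<le> L i i)"
    unfolding loopless_multigraph_colour[OF finV] bal L_def
    by (rule separate_conditions[where T = "\<lambda>_ _. True", simplified simp_thms])
  also have "\<dots> \<longleftrightarrow> balanced Ss \<and>
      (\<forall>i > 0. 2 * Max {min 1 (x_mult Ss l) * count l i | l. is_partition l \<and> size l = i}
                 \<le> label_sum Ss i i)"
    using Max_label_multiplicity_le_iff[OF assms(1)] by (simp add: lab V_def S_def)
  finally show "loopless_multigraph_realizable Ss \<longleftrightarrow> \<dots>" .

  have bound: "d i j v \<le> \<Delta>" if "v \<in> V" for i j v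
    using le_trans[OF chromatic_degree_le_size size_le_max_degree] that
    by (simp add: d_def S_def V_def assms(2))
  have lev: "mset (map (chromatic_degree i j) (filter (\<lambda>S. size S = k) Ss)) =
      image_mset (d i j) (mset_set (level S V k))" for i j k
    by (simp only: mset_map mset_filter_nth level_def V_def d_def S_def
        image_mset.compositionality comp_def)
  have EG: "first_erdos_gallai \<Delta> (D_same Ss i) \<longleftrightarrow> (\<forall>P. top_part (d i i) V P \<longrightarrow>
      sum (d i i) P \<le> card P * (card P - 1) + (\<Sum>u\<in>V - P. min (card P) (d i i u)))" for i
  proof (rule first_erdos_gallai_iff[OF finV _ bound])
    show "mset (D_same Ss i) = image_mset (d i i) (mset_set V)"
      using mset_filter_nth[of "\<lambda>_. True" Ss]
      by (simp add: lessThan_def D_same_def V_def d_def S_def image_mset.compositionality comp_def)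
  qed
  have GR: "first_gale_ryser (\<Delta> - 1) (D_bip Ss i j) \<longleftrightarrow> (\<forall>P. top_part (d i j) (level S V i) P \<longrightarrow>
      sum (d i j) P \<le> (\<Sum>u\<in>level S V j. min (card P) (d i j u)))"
    if "i \<noteq> j" "L i j = L j i" for i j
    unfolding D_bip_def
  proof (rule first_gale_ryser_iff[OF level_finite[OF finV] level_finite[OF finV] lev lev])
    show "sum (d i j) (level S V i) = sum (d i j) (level S V j)"
      using that by (simp add: d_def L_def sum_chromatic_degree)
    show "d i j u \<le> Suc (\<Delta> - 1)" if "u \<in> level S V j" for u
      using bound[of u i j] that by (simp add: level_def)
  qed
  have colour: "(\<exists>F. simple_graph V F \<and> colour_graph S V i j F) \<longleftrightarrow>
      (if i = j then even (L i i) \<and> first_erdos_gallai \<Delta> (D_same Ss i)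
       else L i j = L j i \<and> first_gale_ryser (\<Delta> - 1) (D_bip Ss i j))" for i j
  proof (cases "i = j")
    case True
    then show ?thesis
      using simple_graph_colour[OF finV, of S i i] EG[of i]
      by (simp only: d_def L_def refl if_True)
  next
    case False
    then show ?thesis
      using simple_graph_colour[OF finV, of S i j] GR[OF False]
      by (simp only: d_def L_def if_False cong: conj_cong)
  qed
  have "simple_graph_realizable Ss \<longleftrightarrow> (\<forall>i>0. \<forall>j>0. \<exists>F. simple_graph V F \<and> colour_graph S V i j F)"
    unfolding simple_graph_realizable_def V_def[symmetric] realizes
    by (rule split) (simp_all add: graph_class_by_colours(3)[symmetric] simple_graph_multigraph)
  also have "\<dots> \<longleftrightarrow> (\<forall>i>0. \<forall>j>0. if i = j then even (L i i) \<and> first_erdos_gallai \<Delta> (D_same Ss i)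
      else L i j = L j i \<and> first_gale_ryser (\<Delta> - 1) (D_bip Ss i j))"
    unfolding colour ..
  also have "\<dots> \<longleftrightarrow> balanced Ss \<and> (\<forall>i > 0. first_erdos_gallai \<Delta> (D_same Ss i)) \<and>
      (\<forall>i > 0. \<forall>j > 0. i \<noteq> j \<longrightarrow> first_gale_ryser (\<Delta> - 1) (D_bip Ss i j))"
    unfolding bal by (rule separate_conditions)
  finally show "simple_graph_realizable Ss \<longleftrightarrow> \<dots>" .
qed

end
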